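(* Let $d_1\ge1$ be a fixed integer, let $0<c<\infty$, and suppose that $d_2\to\infty$ with $p=p(d_2)$ such that $\lim_{d_2\to\infty}\frac{p}{d_1d_2}=c$. Let $W$ be the $d_1d_2\times d_1d_2$ complex Wishart matrix and let $W^{R}$ be its right partial transpose. Then the family $\{W,W^{R}\}$ is asymptotically free.
   Context: Complex Wishart matrix: let $G_1,\dots,G_{d_1}$ be $d_2\times p$ random matrices, $G_i=(g^{(i)}_{jk})_{jk}$, where all the $g^{(i)}_{jk}$ are independent complex Gaussian random variables with mean $0$ and $\mathrm E(|g^{(i)}_{jk}|^2)=1$. Put $W(i,j)=\frac1{d_2}G_iG_j^*$ (a $d_2\times d_2$ matrix) and $W=\frac1{d_1}(W(i,j))_{i,j=1}^{d_1}$, a $d_1\times d_1$ block matrix with $d_2\times d_2$ blocks. The right partial transpose is $W^{R}=\frac1{d_1}(W(i,j)^{\mathrm T})_{ij}$. Asymptotic freeness: let $\mathrm{tr}$ denote the normalized trace on $d_1d_2\times d_1d_2$ matrices. A family of random matrices is asymptotically free if all its joint moments with respect to $\mathrm E\circ\mathrm{tr}$ converge, so that it has a limit joint distribution in some non-commutative probability space, and the limit elements are free in that space (equivalently, all mixed free cumulants of the limit vanish). *)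

theory Defs
  imports
    "HOL-Probability.Probability"
    "HOL-Library.Poly_Mapping"
    "Jordan_Normal_Form.Schur_Decomposition"
begin

section \<open>Non-commutative probability spaces and freeness\<close>

locale complex_algebra = vector_space scale
  for scale :: "complex \<Rightarrow> 'a::ring_1 \<Rightarrow> 'a" +
  assumes scale_mult_left: "scale c x * y = scale c (x * y)"
    and scale_mult_right: "x * scale c y = scale c (x * y)"
begin

definition unital_subalgebra :: "'a set \<Rightarrow> bool" where
  "unital_subalgebra S \<longleftrightarrow> subspace S \<and> 1 \<in> S \<and> (\<forall>x\<in>S. \<forall>y\<in>S. x * y \<in> S)"

definition generated_algebra :: "'a set \<Rightarrow> 'a set" where
  "generated_algebra A = unital_subalgebra hull A"

end

locale nc_prob_space = complex_algebra scale
  for scale :: "complex \<Rightarrow> 'a::ring_1 \<Rightarrow> 'a" +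
  fixes \<phi> :: "'a \<Rightarrow> complex"
  assumes state_add: "\<phi> (x + y) = \<phi> x + \<phi> y"
    and state_scale: "\<phi> (scale c x) = c * \<phi> x"
    and state_one: "\<phi> 1 = 1"
begin

definition free_subalgebras :: "('i \<Rightarrow> 'a set) \<Rightarrow> bool" where
  "free_subalgebras A \<longleftrightarrow>
     (\<forall>js bs. js \<noteq> [] \<and> length bs = length js \<and> distinct_adj js \<and>
        (\<forall>k<length js. bs ! k \<in> A (js ! k) \<and> \<phi> (bs ! k) = 0)
        \<longrightarrow> \<phi> (prod_list bs) = 0)"

definition free_family :: "('i \<Rightarrow> 'a) \<Rightarrow> bool" where
  "free_family a \<longleftrightarrow> free_subalgebras (\<lambda>i. generated_algebra {a i})"

end


section \<open>Non-commutative polynomials\<close>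

text \<open>
  Words in the letters \<open>'i\<close>, written additively only because the multiplication of
  \<open>poly_mapping\<close> convolves over an additive monoid. The finitely supported functions from
  words to \<open>complex\<close> are then the unital free algebra in the variables \<open>'i\<close>.
\<close>

datatype 'i fword = Word (letters: "'i list")

instantiation fword :: (type) monoid_add
begin
definition zero_fword :: "'a fword" where "0 = Word []"
definition plus_fword :: "'a fword \<Rightarrow> 'a fword \<Rightarrow> 'a fword"
  where "u + v = Word (letters u @ letters v)"
instance by standard (simp_all add: zero_fword_def plus_fword_def)
end

type_synonym 'i nc_poly = "'i fword \<Rightarrow>\<^sub>0 complex"

definition nc_scale :: "complex \<Rightarrow> 'i nc_poly \<Rightarrow> 'i nc_poly" where
  "nc_scale c q = Poly_Mapping.single 0 c * q"

definition nc_var :: "'i \<Rightarrow> 'i nc_poly" where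
  "nc_var i = Poly_Mapping.single (Word [i]) 1"

lemma nc_poly_induct [case_names monomial add]:
  fixes q :: "'i nc_poly"
  assumes monomial: "\<And>w c. P (Poly_Mapping.single w c)"
    and add: "\<And>q r. P q \<Longrightarrow> P r \<Longrightarrow> P (q + r)"
  shows "P q"
proof (induction q rule: Poly_Mapping.update_induct)
  case const
  show ?case using monomial[of 0 0] by simp
next
  case (update f a b)
  have "Poly_Mapping.update a b f = f + Poly_Mapping.single a b"
    using update(1)
    by (intro poly_mapping_eqI) (auto simp: lookup_update lookup_add lookup_single in_keys_iff)
  then show ?case using update(3) monomial add by simp
qed

lemma nc_scale_complex_algebra: "complex_algebra (nc_scale :: complex \<Rightarrow> 'i nc_poly \<Rightarrow> 'i nc_poly)"
proof -
  have comm: "q * Poly_Mapping.single 0 c = Poly_Mapping.single 0 c * q"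
    for q :: "'i nc_poly" and c
    by (induction q rule: nc_poly_induct) (simp_all add: mult_single algebra_simps)
  show ?thesis
  proof unfold_locales
    fix x y :: "'i nc_poly" and c d :: complex
    show "nc_scale c (x + y) = nc_scale c x + nc_scale c y"
      by (simp add: nc_scale_def algebra_simps)
    show "nc_scale (c + d) x = nc_scale c x + nc_scale d x"
      by (simp add: nc_scale_def single_add algebra_simps)
    show "nc_scale c (nc_scale d x) = nc_scale (c * d) x"
      by (simp add: nc_scale_def mult_single flip: mult.assoc)
    show "nc_scale 1 x = x"
      by (simp add: nc_scale_def)
    show "nc_scale c x * y = nc_scale c (x * y)"
      by (simp add: nc_scale_def mult.assoc)
    show "x * nc_scale c y = nc_scale c (x * y)"
      by (simp add: nc_scale_def comm flip: mult.assoc)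
  qed
qed


section \<open>Random matrices and asymptotic freeness\<close>

definition normalized_trace :: "complex mat \<Rightarrow> complex" where
  "normalized_trace A = (\<Sum>i<dim_row A. A $$ (i, i)) / of_nat (dim_row A)"

definition word_mat :: "nat \<Rightarrow> ('i \<Rightarrow> complex mat) \<Rightarrow> 'i list \<Rightarrow> complex mat" where
  "word_mat N A w = foldr (\<lambda>i B. A i * B) w (1\<^sub>m N)"

text \<open>
  \<open>X n i\<close> is the \<open>i\<close>-th random matrix of size \<open>N n\<close>, on the probability space \<open>M n\<close>.
  Integrability is required because the Bochner integral is \<open>0\<close> by convention when the
  expectation does not exist.
\<close>

definition joint_moments_converge ::
    "(nat \<Rightarrow> 'w measure) \<Rightarrow> (nat \<Rightarrow> nat) \<Rightarrow> (nat \<Rightarrow> 'i \<Rightarrow> 'w \<Rightarrow> complex mat)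
      \<Rightarrow> ('a::ring_1 \<Rightarrow> complex) \<Rightarrow> ('i \<Rightarrow> 'a) \<Rightarrow> bool" where
  "joint_moments_converge M N X \<phi> a \<longleftrightarrow>
     (\<forall>w.
        (\<forall>n. integrable (M n) (\<lambda>\<omega>. normalized_trace (word_mat (N n) (\<lambda>i. X n i \<omega>) w))) \<and>
        (\<lambda>n. integral\<^sup>L (M n) (\<lambda>\<omega>. normalized_trace (word_mat (N n) (\<lambda>i. X n i \<omega>) w)))
          \<longlonglongrightarrow> \<phi> (prod_list (map a w)))"

text \<open>
  HOL cannot quantify over the type carrying the limit space, so the limit joint distribution
  is taken on the free algebra, with the variables as limit elements. No generality is lost:
  see lemma \<open>asymptotically_freeI\<close> below.
\<close>

definition asymptotically_free ::
    "(nat \<Rightarrow> 'w measure) \<Rightarrow> (nat \<Rightarrow> nat) \<Rightarrow> (nat \<Rightarrow> 'i \<Rightarrow> 'w \<Rightarrow> complex mat) \<Rightarrow> bool" where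
  "asymptotically_free M N X \<longleftrightarrow>
     (\<exists>\<phi> :: 'i nc_poly \<Rightarrow> complex.
        nc_prob_space nc_scale \<phi> \<and>
        joint_moments_converge M N X \<phi> nc_var \<and>
        nc_prob_space.free_family nc_scale \<phi> nc_var)"

context complex_algebra
begin

definition nc_eval :: "('i \<Rightarrow> 'a) \<Rightarrow> 'i nc_poly \<Rightarrow> 'a" where
  "nc_eval a q =
     (\<Sum>w\<in>Poly_Mapping.keys q. scale (Poly_Mapping.lookup q w) (prod_list (map a (letters w))))"

lemma nc_eval_superset:
  assumes "finite S" and "Poly_Mapping.keys q \<subseteq> S"
  shows "nc_eval a q = (\<Sum>w\<in>S. scale (Poly_Mapping.lookup q w) (prod_list (map a (letters w))))"
  unfolding nc_eval_def using assms
  by (intro sum.mono_neutral_left) (auto simp: in_keys_iff)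

lemma nc_eval_add: "nc_eval a (q + r) = nc_eval a q + nc_eval a r"
proof -
  let ?S = "Poly_Mapping.keys q \<union> Poly_Mapping.keys r"
  have "finite ?S" by simp
  then show ?thesis
    using keys_add[of q r]
    by (simp add: nc_eval_superset[of ?S] lookup_add scale_left_distrib sum.distrib)
qed

lemma nc_eval_monomial:
  "nc_eval a (Poly_Mapping.single w c) = scale c (prod_list (map a (letters w)))"
  by (simp add: nc_eval_superset[of "{w}"])

lemma nc_eval_mult: "nc_eval a (q * r) = nc_eval a q * nc_eval a r"
proof (induction q rule: nc_poly_induct)
  case (monomial w c)
  show ?case
  proof (induction r rule: nc_poly_induct)
    case (monomial v d)
    show ?case
      by (simp add: mult_single nc_eval_monomial plus_fword_def scale_mult_left scale_mult_right)
  qed (simp add: nc_eval_add distrib_left)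
qed (simp add: nc_eval_add distrib_right)

lemma nc_eval_one: "nc_eval a 1 = 1"
  using nc_eval_monomial[of a 0 1] unfolding single_one by (simp add: zero_fword_def)

lemma nc_eval_nc_scale: "nc_eval a (nc_scale c q) = scale c (nc_eval a q)"
  by (simp add: nc_scale_def nc_eval_mult nc_eval_monomial zero_fword_def scale_mult_left)

lemma nc_eval_nc_var: "nc_eval a (nc_var i) = a i"
  by (simp add: nc_var_def nc_eval_monomial)

lemma nc_eval_prod_list: "nc_eval a (prod_list qs) = prod_list (map (nc_eval a) qs)"
  by (induction qs) (simp_all add: nc_eval_one nc_eval_mult)

lemma generated_algebra_unital_subalgebra: "unital_subalgebra (generated_algebra A)"
  unfolding generated_algebra_def
  by (rule hull_in) (auto simp: unital_subalgebra_def subspace_def)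

end

lemma asymptotically_freeI:
  fixes scale :: "complex \<Rightarrow> 'a::ring_1 \<Rightarrow> 'a" and a :: "'i \<Rightarrow> 'a"
  assumes "nc_prob_space scale \<phi>"
    and "joint_moments_converge M N X \<phi> a"
    and "nc_prob_space.free_family scale \<phi> a"
  shows "asymptotically_free M N X"
proof -
  interpret nc_prob_space scale \<phi> by fact
  interpret P: complex_algebra "nc_scale :: complex \<Rightarrow> 'i nc_poly \<Rightarrow> 'i nc_poly"
    by (rule nc_scale_complex_algebra)
  define \<psi> where "\<psi> = (\<lambda>q. \<phi> (nc_eval a q))"
  interpret Q: nc_prob_space "nc_scale :: complex \<Rightarrow> 'i nc_poly \<Rightarrow> 'i nc_poly" \<psi>
    by unfold_locales
      (simp_all add: \<psi>_def nc_eval_add nc_eval_one nc_eval_nc_scale state_add state_scale state_one)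
  have mem: "nc_eval a q \<in> generated_algebra {a i}" if "q \<in> P.generated_algebra {nc_var i}" for i q
    using that unfolding P.generated_algebra_def
  proof (rule hull_induct)
    fix x :: "'i nc_poly" assume "x \<in> {nc_var i}"
    then show "nc_eval a x \<in> generated_algebra {a i}"
      using hull_subset[of "{a i}" unital_subalgebra]
      by (simp add: nc_eval_nc_var generated_algebra_def)
  next
    have "nc_eval a 0 = 0" by (simp add: nc_eval_def)
    then show "P.unital_subalgebra {q. nc_eval a q \<in> generated_algebra {a i}}"
      using generated_algebra_unital_subalgebra[of "{a i}"]
      by (auto simp: unital_subalgebra_def P.unital_subalgebra_def subspace_def P.subspace_def
          nc_eval_add nc_eval_one nc_eval_mult nc_eval_nc_scale)
  qed
  have "Q.free_family nc_var"
    unfolding Q.free_family_def Q.free_subalgebras_def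
  proof (intro allI impI)
    fix js :: "'i list" and bs :: "'i nc_poly list"
    assume *: "js \<noteq> [] \<and> length bs = length js \<and> distinct_adj js \<and>
      (\<forall>k<length js. bs ! k \<in> P.generated_algebra {nc_var (js ! k)} \<and> \<psi> (bs ! k) = 0)"
    have "\<phi> (prod_list (map (nc_eval a) bs)) = 0"
      using assms(3) * mem unfolding free_family_def free_subalgebras_def
      by (auto simp: \<psi>_def elim!: allE[of _ js] allE[of _ "map (nc_eval a) bs"])
    then show "\<psi> (prod_list bs) = 0"
      by (simp add: \<psi>_def nc_eval_prod_list)
  qed
  moreover have "joint_moments_converge M N X \<psi> nc_var"
  proof -
    have "\<psi> (prod_list (map nc_var w)) = \<phi> (prod_list (map a w))" for w
      by (simp add: \<psi>_def nc_eval_prod_list o_def nc_eval_nc_var)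
    then show ?thesis using assms(2) by (simp add: joint_moments_converge_def)
  qed
  ultimately show ?thesis
    unfolding asymptotically_free_def using Q.nc_prob_space_axioms by blast
qed


section \<open>Complex Wishart matrices\<close>

text \<open>The circular convention: \<open>v\<close> is the expectation of \<open>(cmod Z)\<^sup>2\<close>.\<close>

definition (in prob_space) complex_gaussian :: "real \<Rightarrow> ('a \<Rightarrow> complex) \<Rightarrow> bool" where
  "complex_gaussian v Z \<longleftrightarrow>
     indep_var borel (\<lambda>\<omega>. Re (Z \<omega>)) borel (\<lambda>\<omega>. Im (Z \<omega>)) \<and>
     distributed M lborel (\<lambda>\<omega>. Re (Z \<omega>)) (normal_density 0 (sqrt (v / 2))) \<and>
     distributed M lborel (\<lambda>\<omega>. Im (Z \<omega>)) (normal_density 0 (sqrt (v / 2)))"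

lemma (in prob_space) complex_gaussian_moments:
  assumes "complex_gaussian v Z" and "v > 0"
  shows "integrable M Z" and "expectation Z = 0"
    and "expectation (\<lambda>\<omega>. (cmod (Z \<omega>))\<^sup>2) = v"
proof -
  let ?s = "sqrt (v / 2)"
  have s: "?s > 0" using assms(2) by simp
  have *: "integrable M X \<and> expectation X = 0 \<and> integrable M (\<lambda>\<omega>. (X \<omega>)\<^sup>2)
      \<and> expectation (\<lambda>\<omega>. (X \<omega>)\<^sup>2) = v / 2"
    if D: "distributed M lborel X (normal_density 0 ?s)" for X
  proof -
    have E: "expectation X = 0" by (rule normal_distributed_expectation[OF s D])
    have "variance X = v / 2"
      using normal_distributed_variance[OF s D] assms(2) by simp
    moreover have "integrable M X"
      using integrable_normal_moment[OF s, of 0 1] distributed_integrable[OF D, of "\<lambda>x. x"] by simp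
    moreover have "integrable M (\<lambda>\<omega>. (X \<omega>)\<^sup>2)"
      using integrable_normal_moment[OF s, of 0 2] distributed_integrable[OF D, of "\<lambda>x. x\<^sup>2"]
      by simp
    ultimately show ?thesis using E by simp
  qed
  note R = *[of "\<lambda>\<omega>. Re (Z \<omega>)"] and I = *[of "\<lambda>\<omega>. Im (Z \<omega>)"]
  have "integrable M (\<lambda>\<omega>. complex_of_real (Re (Z \<omega>)) + \<i> * complex_of_real (Im (Z \<omega>)))"
    using R I assms(1)
    by (intro Bochner_Integration.integrable_add integrable_mult_right integrable_of_real)
       (auto simp: complex_gaussian_def)
  then show int: "integrable M Z" by (simp flip: complex_eq)
  show "expectation Z = 0"
    using R I assms(1) int by (simp add: complex_eq_iff complex_gaussian_def)
  show "expectation (\<lambda>\<omega>. (cmod (Z \<omega>))\<^sup>2) = v"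
    using R I assms(1) by (simp add: cmod_power2 complex_gaussian_def)
qed

text \<open>All indices start at \<open>0\<close>: \<open>g i j k\<close> is the entry \<open>(j, k)\<close> of \<open>G\<^sub>i\<close>.\<close>

definition gaussian_entries ::
    "'w measure \<Rightarrow> nat \<Rightarrow> nat \<Rightarrow> nat \<Rightarrow> (nat \<Rightarrow> nat \<Rightarrow> nat \<Rightarrow> 'w \<Rightarrow> complex) \<Rightarrow> bool" where
  "gaussian_entries M d1 d2 p g \<longleftrightarrow>
     prob_space M \<and>
     prob_space.indep_vars M (\<lambda>_. borel) (\<lambda>(i, j, k). g i j k) ({..<d1} \<times> {..<d2} \<times> {..<p}) \<and>
     (\<forall>i<d1. \<forall>j<d2. \<forall>k<p. prob_space.complex_gaussian M 1 (g i j k))"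

definition block_matrix :: "nat \<Rightarrow> nat \<Rightarrow> (nat \<Rightarrow> nat \<Rightarrow> complex mat) \<Rightarrow> complex mat" where
  "block_matrix d1 d2 B =
     Matrix.mat (d1 * d2) (d1 * d2) (\<lambda>(r, s). B (r div d2) (s div d2) $$ (r mod d2, s mod d2))"

definition gaussian_matrix ::
    "nat \<Rightarrow> nat \<Rightarrow> (nat \<Rightarrow> nat \<Rightarrow> nat \<Rightarrow> 'w \<Rightarrow> complex) \<Rightarrow> nat \<Rightarrow> 'w \<Rightarrow> complex mat" where
  "gaussian_matrix d2 p g i \<omega> = Matrix.mat d2 p (\<lambda>(j, k). g i j k \<omega>)"

definition wishart_block ::
    "nat \<Rightarrow> nat \<Rightarrow> (nat \<Rightarrow> nat \<Rightarrow> nat \<Rightarrow> 'w \<Rightarrow> complex) \<Rightarrow> nat \<Rightarrow> nat \<Rightarrow> 'w \<Rightarrow> complex mat" where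
  "wishart_block d2 p g i j \<omega> =
     (1 / of_nat d2) \<cdot>\<^sub>m (gaussian_matrix d2 p g i \<omega> * mat_adjoint (gaussian_matrix d2 p g j \<omega>))"

definition wishart ::
    "nat \<Rightarrow> nat \<Rightarrow> nat \<Rightarrow> (nat \<Rightarrow> nat \<Rightarrow> nat \<Rightarrow> 'w \<Rightarrow> complex) \<Rightarrow> 'w \<Rightarrow> complex mat" where
  "wishart d1 d2 p g \<omega> =
     (1 / of_nat d1) \<cdot>\<^sub>m block_matrix d1 d2 (\<lambda>i j. wishart_block d2 p g i j \<omega>)"

definition wishart_right_transpose ::
    "nat \<Rightarrow> nat \<Rightarrow> nat \<Rightarrow> (nat \<Rightarrow> nat \<Rightarrow> nat \<Rightarrow> 'w \<Rightarrow> complex) \<Rightarrow> 'w \<Rightarrow> complex mat" where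
  "wishart_right_transpose d1 d2 p g \<omega> =
     (1 / of_nat d1) \<cdot>\<^sub>m block_matrix d1 d2 (\<lambda>i j. transpose_mat (wishart_block d2 p g i j \<omega>))"

end

theory Submission
  imports Defs "HOL-Combinatorics.Permutations"
begin

text \<open>
  By Wick's formula the expected trace of a word of length \<open>n\<close> is a sum over permutations \<open>\<sigma>\<close>
  of the letters, each weighted by the number of index assignments compatible with \<open>\<sigma>\<close>. Read the
  word from left to right: whenever a letter is paired with itself, or the letter is paired with its
  neighbour so that their common inner index is free, the letter can be removed, or merged with
  its neighbour, at the price of an explicit factor. If no such reduction exists, every class
  of tied indices has at least two elements, so the weight is of order \<open>1 / d\<^sub>2\<close>. In the limit the
  moments are thus computed by a stack whose entries are the blocks of merged letters that are still open.
  Letters of different kinds are never merged, so a polynomial in one letter acts only on the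
  topmost run of stack entries of its kind. Hence an alternating product of centred polynomials
  leaves a nonempty stack, and its expectation vanishes.
\<close>

text \<open>Kinds do not mix because Wick's formula pairs a Gaussian factor only with a conjugated
  one: where a Wishart letter meets a transposed one, the two inner indices that meet are both
  conjugated or both unconjugated, so no pairing makes their common value free. The partial
  transpose does not reverse the block index, but \<open>d1\<close> is fixed, so this changes only
  constants: merging transposed letters gains \<open>d2\<close> without \<open>d1\<close>, and a
  closed transposed block of even size gains an extra \<open>d1\<close>. The stacks enumerate
  noncrossing partitions whose blocks carry one kind. A closed block of m letters contributes its
  closing weight times m - 1 merging weights, and this is the free cumulant of order m: c in every
  order for the Wishart matrix, and c * d1^(1-m) for odd m, c * d1^(2-m) for even m, for its
  transpose. Fixing the reading order makes the cases at each letter disjoint, so the recursion is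
  an exact identity for every \<open>d2 > 0\<close>. Limits enter only through p / (d1 d2) and
  through the bound for words that are exhausted with blocks still open.\<close>

section \<open>Freeness for stack machines\<close>

text \<open>
  A stack entry \<open>(i, m)\<close> is an open block of \<open>m\<close> merged letters \<open>i\<close>. A letter starts a new
  block or, at the price \<open>\<mu>\<close>, joins the topmost one if the kinds agree; the resulting block stays on
  the stack or is closed with the weight \<open>\<kappa>\<close>. An operator acts on the functions that assign to
  each stack the value of the remaining word.
\<close>

locale stack_machine =
  fixes \<kappa> :: "'i \<times> nat \<Rightarrow> complex" and \<mu> :: "'i \<Rightarrow> complex"
begin

fun letter_op :: "'i \<Rightarrow> (('i \<times> nat) list \<Rightarrow> complex) \<Rightarrow> ('i \<times> nat) list \<Rightarrow> complex" where
  "letter_op i f [] = f [(i, 1)] + \<kappa> (i, 1) * f []"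
| "letter_op i f ((j, m) # u) = f ((i, 1) # (j, m) # u) + \<kappa> (i, 1) * f ((j, m) # u)
     + (if j = i then \<mu> i * (f ((i, Suc m) # u) + \<kappa> (i, Suc m) * f u) else 0)"

definition vacuum :: "('i \<times> nat) list \<Rightarrow> complex" where
  "vacuum u = of_bool (u = [])"

definition word_op :: "'i list \<Rightarrow> (('i \<times> nat) list \<Rightarrow> complex) \<Rightarrow> ('i \<times> nat) list \<Rightarrow> complex" where
  "word_op w f = foldr letter_op w f"

definition poly_op :: "'i nc_poly \<Rightarrow> (('i \<times> nat) list \<Rightarrow> complex) \<Rightarrow> ('i \<times> nat) list \<Rightarrow> complex" where
  "poly_op q f = (\<lambda>u. \<Sum>w\<in>Poly_Mapping.keys q. Poly_Mapping.lookup q w * word_op (letters w) f u)"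

definition state :: "'i nc_poly \<Rightarrow> complex" where
  "state q = poly_op q vacuum []"

section \<open>Linearity of the operators and the product rule\<close>

lemma letter_op_linear:
  "letter_op i (\<lambda>u. a * f u + b * h u) = (\<lambda>u. a * letter_op i f u + b * letter_op i h u)"
proof
  fix u show "letter_op i (\<lambda>u. a * f u + b * h u) u = a * letter_op i f u + b * letter_op i h u"
    by (cases u) (auto simp: algebra_simps)
qed

lemma word_op_linear:
  "word_op w (\<lambda>u. a * f u + b * h u) = (\<lambda>u. a * word_op w f u + b * word_op w h u)"
  by (induction w) (simp_all add: word_op_def letter_op_linear)

lemma word_op_append: "word_op (v @ w) f = word_op v (word_op w f)"
  by (simp add: word_op_def)

lemma poly_op_superset:
  assumes "finite S" and "Poly_Mapping.keys q \<subseteq> S"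
  shows "poly_op q f u = (\<Sum>w\<in>S. Poly_Mapping.lookup q w * word_op (letters w) f u)"
  unfolding poly_op_def using assms
  by (intro sum.mono_neutral_left) (auto simp: in_keys_iff)

lemma poly_op_add: "poly_op (q + r) f = (\<lambda>u. poly_op q f u + poly_op r f u)"
proof
  fix u
  let ?S = "Poly_Mapping.keys q \<union> Poly_Mapping.keys r"
  have "finite ?S" by simp
  then show "poly_op (q + r) f u = poly_op q f u + poly_op r f u"
    using keys_add[of q r]
    by (simp add: poly_op_superset[of ?S] lookup_add distrib_right sum.distrib)
qed

lemma poly_op_monomial:
  "poly_op (Poly_Mapping.single w c) f = (\<lambda>u. c * word_op (letters w) f u)"
  by (rule ext) (simp add: poly_op_superset[of "{w}"])

lemma poly_op_zero: "poly_op 0 f = (\<lambda>u. 0)"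
  by (simp add: poly_op_def)

lemma poly_op_linear:
  "poly_op q (\<lambda>u. a * f u + b * h u) = (\<lambda>u. a * poly_op q f u + b * poly_op q h u)"
  by (induction q rule: nc_poly_induct)
    (simp_all add: poly_op_monomial poly_op_add word_op_linear algebra_simps)

text \<open>The operators transform the value of the unread rest, not the stack. The left factor is
  therefore applied last: it is read first, when everything to its right is summarised in one
  function of the stack.\<close>

lemma poly_op_mult: "poly_op (q * r) f = poly_op q (poly_op r f)"
proof (induction q rule: nc_poly_induct)
  case (monomial w c)
  show ?case
  proof (induction r rule: nc_poly_induct)
    case (monomial v d)
    show ?case
      \<comment> \<open>Homogeneity is the case of linearity with second coefficient 0.\<close>
      using word_op_linear[of "letters w" d _ 0]
      by (simp add: mult_single poly_op_monomial plus_fword_def word_op_append mult.assoc)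
  next
    case (add r s)
    then show ?case
      using poly_op_linear[of "Poly_Mapping.single w c" 1 "poly_op r f" 1 "poly_op s f"]
      by (simp add: poly_op_add distrib_left)
  qed
qed (simp add: poly_op_add distrib_right)

lemma poly_op_one: "poly_op 1 f = f"
  using poly_op_monomial[of 0 1 f] unfolding single_one by (simp add: zero_fword_def word_op_def)

lemma poly_op_nc_scale: "poly_op (nc_scale c q) f = (\<lambda>u. c * poly_op q f u)"
  by (simp add: nc_scale_def poly_op_mult poly_op_monomial zero_fword_def word_op_def)

lemma poly_op_nc_var: "poly_op (nc_var i) f = letter_op i f"
  by (simp add: nc_var_def poly_op_monomial word_op_def)

lemma poly_op_word: "poly_op (prod_list (map nc_var w)) f = word_op w f"
  by (induction w) (simp_all add: poly_op_one poly_op_mult poly_op_nc_var word_op_def)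

lemma state_word: "state (prod_list (map nc_var w)) = word_op w vacuum []"
  by (simp add: state_def poly_op_word)

section \<open>Locality at the top of the stack, and freeness\<close>

definition one_coloured :: "'i \<Rightarrow> ('i \<times> nat) list \<Rightarrow> bool" where
  "one_coloured i t \<longleftrightarrow> (\<forall>x\<in>set t. fst x = i)"

definition top_differs :: "'i \<Rightarrow> ('i \<times> nat) list \<Rightarrow> bool" where
  "top_differs i u \<longleftrightarrow> u = [] \<or> fst (hd u) \<noteq> i"

text \<open>An element of the algebra generated by one letter only sees the topmost run of the stack
  that carries this letter.\<close>

definition top_local :: "'i \<Rightarrow> 'i nc_poly \<Rightarrow> bool" where
  "top_local i q \<longleftrightarrow> (\<forall>f h u. top_differs i u \<longrightarrow>
     (\<forall>t. one_coloured i t \<longrightarrow> f (t @ u) = h t) \<longrightarrow>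
     (\<forall>t. one_coloured i t \<longrightarrow> poly_op q f (t @ u) = poly_op q h t))"

lemma top_localD:
  assumes "top_local i q" and "top_differs i u"
    and "\<forall>t. one_coloured i t \<longrightarrow> f (t @ u) = h t" and "one_coloured i t"
  shows "poly_op q f (t @ u) = poly_op q h t"
  using assms unfolding top_local_def by blast

text \<open>\<open>letter_op\<close> inspects and removes at most the top entry. When the run
  \<open>t\<close> is empty, \<open>top_differs\<close> switches off the merging branch over
  \<open>u\<close>, just as it is off on the empty stack.\<close>

lemma top_local_nc_var: "top_local i (nc_var i)"
  unfolding top_local_def
proof (intro allI impI)
  fix f h :: "('i \<times> nat) list \<Rightarrow> complex" and u t :: "('i \<times> nat) list"
  assume u: "top_differs i u" and eq: "\<forall>t. one_coloured i t \<longrightarrow> f (t @ u) = h t"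
    and t: "one_coloured i t"
  have e: "f (s @ u) = h s" if "one_coloured i s" for s using eq that by blast
  show "poly_op (nc_var i) f (t @ u) = poly_op (nc_var i) h t"
  proof (cases t)
    case Nil
    then show ?thesis
      using u e[of "[]"] e[of "[(i, 1)]"]
      by (cases u) (auto simp: poly_op_nc_var one_coloured_def top_differs_def)
  next
    case (Cons x s)
    obtain m where x: "x = (i, m)" using t Cons by (cases x) (auto simp: one_coloured_def)
    have s: "one_coloured i s" using t Cons by (auto simp: one_coloured_def)
    then have "one_coloured i ((i, 1) # (i, m) # s)" "one_coloured i ((i, m) # s)"
        "one_coloured i ((i, Suc m) # s)"
      by (auto simp: one_coloured_def)
    from this[THEN e] e[OF s] show ?thesis
      by (simp add: Cons x poly_op_nc_var)
  qed
qed

text \<open>The local polynomials form a unital subalgebra. For a product, the right factor turns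
  two functions that agree on the runs into two such functions again, to which the left factor
  applies.\<close>

lemma top_local_generated:
  assumes "q \<in> complex_algebra.generated_algebra nc_scale {nc_var i}"
  shows "top_local i q"
proof -
  interpret P: complex_algebra "nc_scale :: complex \<Rightarrow> 'i nc_poly \<Rightarrow> 'i nc_poly"
    by (rule nc_scale_complex_algebra)
  show ?thesis
    using assms unfolding P.generated_algebra_def
  proof (rule hull_induct)
    show "top_local i x" if "x \<in> {nc_var i}" for x
      using that top_local_nc_var by simp
    have "top_local i (x * y)" if x: "top_local i x" and y: "top_local i y" for x y
      unfolding top_local_def poly_op_mult
    proof (intro allI impI)
      fix f h :: "('i \<times> nat) list \<Rightarrow> complex" and u t :: "('i \<times> nat) list"
      assume u: "top_differs i u" and eq: "\<forall>t. one_coloured i t \<longrightarrow> f (t @ u) = h t"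
        and t: "one_coloured i t"
      have "\<forall>t. one_coloured i t \<longrightarrow> poly_op y f (t @ u) = poly_op y h t"
        using top_localD[OF y u eq] by blast
      then show "poly_op x (poly_op y f) (t @ u) = poly_op x (poly_op y h) t"
        using top_localD[OF x u _ t] by blast
    qed
    moreover have "top_local i (x + y)" if "top_local i x" "top_local i y" for x y
      unfolding top_local_def poly_op_add using top_localD[OF that(1)] top_localD[OF that(2)]
      by (intro allI impI arg_cong2[where f = "(+)"]) blast+
    moreover have "top_local i (nc_scale c x)" if "top_local i x" for c x
      unfolding top_local_def poly_op_nc_scale using top_localD[OF that]
      by (intro allI impI arg_cong2[where f = "(*)"] refl) blast
    moreover have "top_local i 0" "top_local i 1"
      by (simp_all add: top_local_def poly_op_zero poly_op_one)
    ultimately show "P.unital_subalgebra {q. top_local i q}"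
      by (simp add: P.unital_subalgebra_def P.subspace_def)
  qed
qed

text \<open>The value of the remaining product is a function of the run that the first factor leaves
  behind. By induction it is zero on nonempty runs, whose kind differs from the next one. On runs it
  is thus a multiple of \<open>vacuum\<close>, and the first factor maps it to a multiple of its own
  \<open>state\<close>, which is 0.\<close>

lemma centred_product_vanishes:
  assumes "length bs = length js" and "distinct_adj js" and "js \<noteq> []"
    and "\<forall>k<length js. top_local (js ! k) (bs ! k) \<and> state (bs ! k) = 0"
    and "top_differs (hd js) u"
  shows "poly_op (prod_list bs) vacuum u = 0"
  using assms
proof (induction js arbitrary: bs u)
  case (Cons j js)
  from Cons.prems(1) obtain b bs' where bs: "bs = b # bs'" by (cases bs) auto
  have b: "top_local j b" "state b = 0" using Cons.prems(4) bs by force+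
  let ?f = "poly_op (prod_list bs') vacuum"
  have f0: "?f (t @ u) = 0" if t: "one_coloured j t" "t \<noteq> []" for t
  proof (cases "js = []")
    case True
    then have "bs' = []" using Cons.prems(1) bs by simp
    then show ?thesis using t by (simp add: poly_op_one vacuum_def)
  next
    case False
    have "top_differs (hd js) (t @ u)"
      using t Cons.prems(2) False by (cases js; cases t) (auto simp: top_differs_def one_coloured_def)
    moreover have "\<forall>k<length js. top_local (js ! k) (bs' ! k) \<and> state (bs' ! k) = 0"
    proof (intro allI impI)
      fix k assume "k < length js"
      then show "top_local (js ! k) (bs' ! k) \<and> state (bs' ! k) = 0"
        using Cons.prems(4)[rule_format, of "Suc k"] bs by simp
    qed
    ultimately show ?thesis
      using Cons.IH[of bs' "t @ u"] Cons.prems False bs by (cases js) auto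
  qed
  \<comment> \<open>The summand with coefficient 0 only gives the right side the shape of
    \<open>poly_op_linear\<close>.\<close>
  have eq: "\<forall>t. one_coloured j t \<longrightarrow> ?f (t @ u) = ?f u * vacuum t + 0 * vacuum t"
  proof (intro allI impI)
    fix t assume t: "one_coloured j t"
    show "?f (t @ u) = ?f u * vacuum t + 0 * vacuum t"
      using f0[OF t] by (cases "t = []") (auto simp: vacuum_def)
  qed
  have "top_differs j u" using Cons.prems(5) by simp
  from top_localD[OF b(1) this eq, of "[]"]
  have "poly_op b ?f u = poly_op b (\<lambda>t. ?f u * vacuum t + 0 * vacuum t) []"
    by (simp add: one_coloured_def)
  also have "\<dots> = ?f u * state b"
    unfolding poly_op_linear by (simp add: state_def)
  finally show ?case using b by (simp add: bs poly_op_mult)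
qed simp

lemma state_nc_prob_space: "nc_prob_space nc_scale state"
proof -
  interpret P: complex_algebra "nc_scale :: complex \<Rightarrow> 'i nc_poly \<Rightarrow> 'i nc_poly"
    by (rule nc_scale_complex_algebra)
  show ?thesis
    by unfold_locales
      (simp_all add: state_def poly_op_add poly_op_nc_scale poly_op_one vacuum_def)
qed

lemma state_free: "nc_prob_space.free_family nc_scale state nc_var"
proof -
  interpret P: nc_prob_space nc_scale state by (rule state_nc_prob_space)
  show ?thesis
    unfolding P.free_family_def P.free_subalgebras_def
  proof (intro allI impI)
    fix js :: "'i list" and bs :: "'i nc_poly list"
    assume "js \<noteq> [] \<and> length bs = length js \<and> distinct_adj js \<and>
      (\<forall>k<length js. bs ! k \<in> P.generated_algebra {nc_var (js ! k)} \<and> state (bs ! k) = 0)"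
    then show "state (prod_list bs) = 0"
      using centred_product_vanishes[of bs js "[]"]
      by (auto simp: state_def top_differs_def intro: top_local_generated)
  qed
qed

end

section \<open>Counting index assignments\<close>

text \<open>The notation \<open>inv\<close> is taken by the group inverse of \<open>HOL-Algebra\<close>.\<close>

abbreviation pinv :: "('a \<Rightarrow> 'b) \<Rightarrow> 'b \<Rightarrow> 'a" where
  "pinv \<equiv> inv_into UNIV"

text \<open>
  A letter \<open>l\<close> carries the index \<open>g l\<close> of its Gaussian factor and the index \<open>h l\<close> of its
  conjugated factor. In a matrix product its left and right index are \<open>g l\<close> and \<open>h l\<close> (\<open>Fwd\<close>), or
  \<open>h l\<close> and \<open>g l\<close> (\<open>Bwd\<close>), or the letter is an identity matrix times the trace over
  its own index (\<open>Pass\<close>).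
\<close>

datatype direction = Fwd | Bwd | Pass

fun index_chain :: "(nat \<Rightarrow> nat) \<Rightarrow> (nat \<Rightarrow> nat) \<Rightarrow> nat \<Rightarrow> (nat \<times> direction) list \<Rightarrow> nat \<Rightarrow> bool" where
  "index_chain g h x [] y \<longleftrightarrow> x = y"
| "index_chain g h x ((l, Fwd) # ls) y \<longleftrightarrow> g l = x \<and> index_chain g h (h l) ls y"
| "index_chain g h x ((l, Bwd) # ls) y \<longleftrightarrow> h l = x \<and> index_chain g h (g l) ls y"
| "index_chain g h x ((l, Pass) # ls) y \<longleftrightarrow> g l = h l \<and> index_chain g h x ls y"

lemma index_chain_append:
  "index_chain g h x (us @ vs) y \<longleftrightarrow> (\<exists>m. index_chain g h x us m \<and> index_chain g h m vs y)"
  by (induction g h x us y rule: index_chain.induct) auto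

lemma index_chain_unique: "index_chain g h x us m \<Longrightarrow> index_chain g h x us m' \<Longrightarrow> m = m'"
  by (induction g h x us m rule: index_chain.induct) auto

lemma index_chain_cong:
  assumes "\<And>l. l \<in> fst ` set us \<Longrightarrow> g l = g' l" and "\<And>l. l \<in> fst ` set us \<Longrightarrow> h l = h' l"
  shows "index_chain g h x us y \<longleftrightarrow> index_chain g' h' x us y"
  using assms by (induction g h x us y rule: index_chain.induct) auto

lemma index_chain_range:
  assumes "index_chain g h x us y" and "x \<in> D"
    and "\<And>l. l \<in> fst ` set us \<Longrightarrow> g l \<in> D" and "\<And>l. l \<in> fst ` set us \<Longrightarrow> h l \<in> D"
  shows "y \<in> D"
  using assms by (induction g h x us y rule: index_chain.induct) auto

text \<open>Every removal or contraction rule below is an instance: \<open>c\<close> is the number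
  of values left for the removed label, 1 if its value is forced and the full range if it is
  free.\<close>

lemma card_PiE_insert_fibres:
  assumes "finite V" and "l \<notin> V" and "finite D"
    and fibre: "\<And>f. f \<in> PiE V (\<lambda>_. D) \<Longrightarrow> card {v \<in> D. P (f(l := v))} = (if Q f then c else 0)"
  shows "card {f \<in> PiE (insert l V) (\<lambda>_. D). P f} = c * card {f \<in> PiE V (\<lambda>_. D). Q f}"
proof -
  let ?A = "SIGMA f:PiE V (\<lambda>_. D). {v \<in> D. P (f(l := v))}"
  have eq: "{f \<in> PiE (insert l V) (\<lambda>_. D). P f} = (\<lambda>(f, v). f(l := v)) ` ?A"
    by (auto simp: PiE_insert_eq image_iff) 
  have "inj_on (\<lambda>(f, v). f(l := v)) ?A"
  proof (rule inj_onI, clarify)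
    fix f v f' v'
    assume f: "f \<in> PiE V (\<lambda>_. D)" "f' \<in> PiE V (\<lambda>_. D)" and e: "f(l := v) = f'(l := v')"
    have "f w = f' w" for w
      using fun_cong[OF e, of w] f \<open>l \<notin> V\<close> by (cases "w = l") (auto simp: PiE_def extensional_def)
    then show "f = f' \<and> v = v'" using fun_cong[OF e, of l] by auto
  qed
  then have "card {f \<in> PiE (insert l V) (\<lambda>_. D). P f} = card ?A"
    unfolding eq by (rule card_image)
  also have "\<dots> = (\<Sum>f\<in>PiE V (\<lambda>_. D). card {v \<in> D. P (f(l := v))})"
    using assms by (intro card_SigmaI) (auto intro: finite_PiE)
  also have "\<dots> = (\<Sum>f\<in>PiE V (\<lambda>_. D). if Q f then c else 0)"
    using fibre by (intro sum.cong) auto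
  also have "\<dots> = c * card {f \<in> PiE V (\<lambda>_. D). Q f}"
    using assms by (subst sum.If_cases) (auto intro: finite_PiE simp: Int_def conj_commute)
  finally show ?thesis .
qed

text \<open>Wick pairing makes \<open>h\<close> equal to \<open>g \<circ> \<sigma>\<^sup>-\<^sup>1\<close>, so only \<open>g\<close> is counted.
  The label \<open>0\<close> is reserved for the index at which the cyclic word is cut open.\<close>

definition closed_count :: "nat \<Rightarrow> (nat \<times> direction) list \<Rightarrow> (nat \<Rightarrow> nat) \<Rightarrow> nat" where
  "closed_count d xs \<sigma> = card {f \<in> PiE (insert 0 (fst ` set xs)) (\<lambda>_. {..<d}).
     index_chain f (f \<circ> pinv \<sigma>) (f 0) xs (f 0)}"

definition cycle_count :: "nat \<Rightarrow> nat set \<Rightarrow> (nat \<Rightarrow> nat) \<Rightarrow> nat" where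
  "cycle_count d S \<sigma> = card {f \<in> PiE S (\<lambda>_. {..<d}). \<forall>l\<in>S. f (\<sigma> l) = f l}"

text \<open>A letter paired with itself has equal indices on both sides. For \<open>Fwd\<close> and
  \<open>Bwd\<close> it hands on the index it receives, so its value is forced by the chain before
  it. A \<open>Pass\<close> letter then imposes no condition, which leaves \<open>d\<close>
  values.\<close>

lemma closed_count_fixed_point:
  assumes \<sigma>: "\<sigma> permutes fst ` set (us @ vs)"
    and l: "l \<notin> fst ` set (us @ vs)" "l \<noteq> 0" and S0: "0 \<notin> fst ` set (us @ vs)"
  shows "closed_count d (us @ (l, k) # vs) \<sigma> =
    (if k = Pass then d else 1) * closed_count d (us @ vs) \<sigma>"
proof -
  let ?S = "fst ` set (us @ vs)"
  have invp: "pinv \<sigma> permutes ?S" using permutes_inv[OF \<sigma>] .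
  have invl: "pinv \<sigma> l = l" by (rule permutes_not_in[OF invp l(1)])
  have invS: "pinv \<sigma> w \<noteq> l" if "w \<in> ?S" for w
    using permutes_in_image[OF invp, of w] that l by metis
  have invD: "pinv \<sigma> w \<in> ?S" if "w \<in> ?S" for w
    using permutes_in_image[OF invp, of w] that by metis
  have ins: "insert 0 (fst ` set (us @ (l, k) # vs)) = insert l (insert 0 ?S)" by auto
  have fibre: "card {v \<in> {..<d}. index_chain (f(l := v)) (f(l := v) \<circ> pinv \<sigma>) ((f(l := v)) 0)
        (us @ (l, k) # vs) ((f(l := v)) 0)} =
      (if index_chain f (f \<circ> pinv \<sigma>) (f 0) (us @ vs) (f 0) then if k = Pass then d else 1 else 0)"
    if f: "f \<in> PiE (insert 0 ?S) (\<lambda>_. {..<d})" for f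
  proof -
    have cong: "index_chain (f(l := v)) (f(l := v) \<circ> pinv \<sigma>) x ws y \<longleftrightarrow> index_chain f (f \<circ> pinv \<sigma>) x ws y"
      if "set ws \<subseteq> set (us @ vs)" for v x ws y
    proof (rule index_chain_cong)
      fix w assume "w \<in> fst ` set ws"
      then have w: "w \<in> ?S" using that by auto
      then show "(f(l := v)) w = f w" using l by auto
      show "(f(l := v) \<circ> pinv \<sigma>) w = (f \<circ> pinv \<sigma>) w"
        using invS[OF w] by simp
    qed
    have cu: "index_chain (f(l := v)) (f(l := v) \<circ> pinv \<sigma>) x us y \<longleftrightarrow> index_chain f (f \<circ> pinv \<sigma>) x us y"
      and cv: "index_chain (f(l := v)) (f(l := v) \<circ> pinv \<sigma>) x vs y \<longleftrightarrow> index_chain f (f \<circ> pinv \<sigma>) x vs y"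
      for v x y by (rule cong; simp)+
    show ?thesis
    proof (cases "k = Pass")
      case True
      then show ?thesis
        using l by (simp add: index_chain_append cu cv invl)
    next
      case False
      then have *: "index_chain (f(l := v)) (f(l := v) \<circ> pinv \<sigma>) ((f(l := v)) 0)
          (us @ (l, k) # vs) ((f(l := v)) 0) \<longleftrightarrow>
        index_chain f (f \<circ> pinv \<sigma>) (f 0) us v \<and> index_chain f (f \<circ> pinv \<sigma>) v vs (f 0)" for v
        using l by (cases k) (auto simp: index_chain_append cu cv invl)
      show ?thesis
      proof (cases "index_chain f (f \<circ> pinv \<sigma>) (f 0) (us @ vs) (f 0)")
        case t: True
        then obtain m where m: "index_chain f (f \<circ> pinv \<sigma>) (f 0) us m" "index_chain f (f \<circ> pinv \<sigma>) m vs (f 0)"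
          by (auto simp: index_chain_append)
        have "m \<in> {..<d}"
        proof (rule index_chain_range[OF m(1)])
          fix w assume "w \<in> fst ` set us"
          then have w: "w \<in> ?S" by auto
          show "f w \<in> {..<d}" "(f \<circ> pinv \<sigma>) w \<in> {..<d}"
            using PiE_mem[OF f, of w] PiE_mem[OF f, of "pinv \<sigma> w"] w invD[OF w] by auto
        qed (use PiE_mem[OF f] in auto)
        then have "{v \<in> {..<d}. index_chain f (f \<circ> pinv \<sigma>) (f 0) us v \<and> index_chain f (f \<circ> pinv \<sigma>) v vs (f 0)} = {m}"
          using m index_chain_unique by auto
        then show ?thesis unfolding * using False t by simp
      next
        case False
        then have "{v \<in> {..<d}. index_chain f (f \<circ> pinv \<sigma>) (f 0) us v \<and> index_chain f (f \<circ> pinv \<sigma>) v vs (f 0)} = {}"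
          by (auto simp: index_chain_append)
        then show ?thesis unfolding * using False by simp
      qed
    qed
  qed
  show ?thesis
    unfolding closed_count_def ins
    by (rule card_PiE_insert_fibres) (use l S0 fibre in auto)
qed

text \<open>If \<open>y\<close> is paired with \<open>z\<close>, these two factors disappear, and the other two factors of
  \<open>y\<close> and \<open>z\<close> form a single letter, which keeps the label \<open>z\<close>.\<close>

context
  fixes \<sigma> :: "nat \<Rightarrow> nat" and us vs :: "(nat \<times> direction) list" and y z :: nat
  assumes \<sigma>: "\<sigma> permutes insert z (fst ` set (us @ vs))"
    and z: "z \<notin> fst ` set (us @ vs)" "z \<noteq> 0"
    and y: "y \<notin> fst ` set (us @ vs)" "y \<noteq> z" "y \<noteq> 0"
    and S0: "0 \<notin> fst ` set (us @ vs)"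
begin

lemma contraction_inv:
  shows "pinv (Transposition.transpose y z \<circ> \<sigma>) = pinv \<sigma> \<circ> Transposition.transpose y z"
  using permutes_bij[OF \<sigma>] by (simp add: o_inv_distrib inv_transpose_eq)

lemma contraction_inv_kept: "pinv (Transposition.transpose y z \<circ> \<sigma>) z = y"
proof -
  have "pinv \<sigma> y = y" by (rule permutes_not_in[OF permutes_inv[OF \<sigma>]]) (use y in auto)
  then show ?thesis by (simp add: contraction_inv)
qed

lemma contraction_inv_removed: "pinv (Transposition.transpose y z \<circ> \<sigma>) y = pinv \<sigma> z"
  by (simp add: contraction_inv)

lemma contraction_inv_other: "w \<in> fst ` set (us @ vs) \<Longrightarrow> pinv (Transposition.transpose y z \<circ> \<sigma>) w = pinv \<sigma> w"
  using y z by (simp add: contraction_inv) (metis transpose_apply_other)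

lemma inv_in_labels: "w \<in> insert z (fst ` set (us @ vs)) \<Longrightarrow> pinv \<sigma> w \<in> insert z (fst ` set (us @ vs))"
  using permutes_in_image[OF permutes_inv[OF \<sigma>]] by blast

lemma inv_neq_removed: "w \<in> insert z (fst ` set (us @ vs)) \<Longrightarrow> pinv \<sigma> w \<noteq> y"
  using inv_in_labels[of w] y by auto

lemma contraction_chain:
  assumes "set ws \<subseteq> set (us @ vs)"
  shows "index_chain (f(y := v)) (f(y := v) \<circ> pinv (Transposition.transpose y z \<circ> \<sigma>)) a ws b \<longleftrightarrow>
    index_chain f (f \<circ> pinv \<sigma>) a ws b"
proof (rule index_chain_cong)
  fix w assume "w \<in> fst ` set ws"
  then have w: "w \<in> fst ` set (us @ vs)" using assms by auto
  then show "(f(y := v)) w = f w" using y by auto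
  show "(f(y := v) \<circ> pinv (Transposition.transpose y z \<circ> \<sigma>)) w = (f \<circ> pinv \<sigma>) w"
    using contraction_inv_other[OF w] inv_neq_removed[of w] w by auto
qed

lemma contraction_chain_parts:
  "index_chain (f(y := v)) (f(y := v) \<circ> pinv (Transposition.transpose y z \<circ> \<sigma>)) a us b \<longleftrightarrow>
    index_chain f (f \<circ> pinv \<sigma>) a us b"
  "index_chain (f(y := v)) (f(y := v) \<circ> pinv (Transposition.transpose y z \<circ> \<sigma>)) a vs b \<longleftrightarrow>
    index_chain f (f \<circ> pinv \<sigma>) a vs b"
  by (rule contraction_chain; simp)+

text \<open>The new value \<open>v\<close> is shared by the two paired factors, the g-index of
  \<open>y\<close> and the h-index of \<open>z\<close>. The surviving g-index of \<open>z\<close>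
  and h-index of \<open>y\<close> are the two indices of the label \<open>z\<close> under
  \<open>\<sigma>\<close>.\<close>

lemma contraction_values:
  "(f(y := v)) (pinv (Transposition.transpose y z \<circ> \<sigma>) z) = v"
  "(f(y := v)) (pinv (Transposition.transpose y z \<circ> \<sigma>) y) = f (pinv \<sigma> z)"
  "(f(y := v)) 0 = f 0" "(f(y := v)) z = f z" "(f(y := v)) y = v"
  using contraction_inv_kept contraction_inv_removed inv_neq_removed[of z] y by auto

lemma closed_count_contract_free:
  assumes labels: "fst ` set xs = insert y (insert z (fst ` set (us @ vs)))"
    and chain: "\<And>f v. index_chain (f(y := v)) (f(y := v) \<circ> pinv (Transposition.transpose y z \<circ> \<sigma>)) (f 0) xs (f 0) \<longleftrightarrow>
      index_chain f (f \<circ> pinv \<sigma>) (f 0) (us @ (z, k) # vs) (f 0)"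
  shows "closed_count d xs (Transposition.transpose y z \<circ> \<sigma>) = d * closed_count d (us @ (z, k) # vs) \<sigma>"
proof -
  have ins: "insert 0 (fst ` set xs) = insert y (insert 0 (fst ` set (us @ (z, k) # vs)))"
    unfolding labels by auto
  show ?thesis
    unfolding closed_count_def ins
    by (rule card_PiE_insert_fibres) (use y chain in \<open>auto simp del: index_chain.simps\<close>)
qed

lemma closed_count_contract_determined:
  assumes labels: "fst ` set xs = insert y (insert z (fst ` set (us @ vs)))"
    and chain: "\<And>f v. index_chain (f(y := v)) (f(y := v) \<circ> pinv (Transposition.transpose y z \<circ> \<sigma>)) (f 0) xs (f 0) \<longleftrightarrow>
      index_chain f (f \<circ> pinv \<sigma>) (f 0) (us @ (z, k) # vs) (f 0) \<and> Q f v"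
    and Q: "\<And>f. f \<in> PiE (insert 0 (fst ` set (us @ (z, k) # vs))) (\<lambda>_. {..<d}) \<Longrightarrow>
      index_chain f (f \<circ> pinv \<sigma>) (f 0) (us @ (z, k) # vs) (f 0) \<Longrightarrow> \<exists>!v. v \<in> {..<d} \<and> Q f v"
  shows "closed_count d xs (Transposition.transpose y z \<circ> \<sigma>) = closed_count d (us @ (z, k) # vs) \<sigma>"
proof -
  have ins: "insert 0 (fst ` set xs) = insert y (insert 0 (fst ` set (us @ (z, k) # vs)))"
    unfolding labels by auto
  have fibre: "card {v \<in> {..<d}. index_chain (f(y := v)) (f(y := v) \<circ> pinv (Transposition.transpose y z \<circ> \<sigma>))
        ((f(y := v)) 0) xs ((f(y := v)) 0)} =
      (if index_chain f (f \<circ> pinv \<sigma>) (f 0) (us @ (z, k) # vs) (f 0) then 1 else 0)"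
    if f: "f \<in> PiE (insert 0 (fst ` set (us @ (z, k) # vs))) (\<lambda>_. {..<d})" for f
  proof (cases "index_chain f (f \<circ> pinv \<sigma>) (f 0) (us @ (z, k) # vs) (f 0)")
    case True
    from Q[OF f True] obtain m where "{v. v \<in> {..<d} \<and> Q f v} = {m}" by auto
    then have "card {v \<in> {..<d}. Q f v} = 1" by simp
    then show ?thesis using True y by (simp add: chain)
  next
    case False
    then show ?thesis using y by (simp add: chain)
  qed
  have "closed_count d xs (Transposition.transpose y z \<circ> \<sigma>) = 1 * closed_count d (us @ (z, k) # vs) \<sigma>"
    unfolding closed_count_def ins
    by (rule card_PiE_insert_fibres) (use y fibre in auto)
  then show ?thesis by simp
qed

text \<open>The indices meeting between the two letters are the paired ones. The pairing already
  makes them equal, so their common value is unconstrained.\<close>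

lemma closed_count_contract_Fwd:
  "closed_count d (us @ (z, Fwd) # (y, Fwd) # vs) (Transposition.transpose y z \<circ> \<sigma>) =
    d * closed_count d (us @ (z, Fwd) # vs) \<sigma>"
  by (rule closed_count_contract_free)
    (auto simp: index_chain_append contraction_chain_parts contraction_values simp del: fun_upd_apply)

lemma closed_count_contract_Bwd:
  "closed_count d (us @ (y, Bwd) # (z, Bwd) # vs) (Transposition.transpose y z \<circ> \<sigma>) =
    d * closed_count d (us @ (z, Bwd) # vs) \<sigma>"
  by (rule closed_count_contract_free)
    (auto simp: index_chain_append contraction_chain_parts contraction_values simp del: fun_upd_apply)

text \<open>Here the surviving indices meet, and their equality is the condition of a
  \<open>Pass\<close> letter. The shared value sits at both outer ends, so it is forced to be the
  index reached after \<open>us\<close>.\<close>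

lemma closed_count_contract_Fwd_Fwd:
  "closed_count d (us @ (y, Fwd) # (z, Fwd) # vs) (Transposition.transpose y z \<circ> \<sigma>) =
    closed_count d (us @ (z, Pass) # vs) \<sigma>"
proof (rule closed_count_contract_determined)
  fix f :: "nat \<Rightarrow> nat" and v
  show "index_chain (f(y := v)) (f(y := v) \<circ> pinv (Transposition.transpose y z \<circ> \<sigma>)) (f 0)
      (us @ (y, Fwd) # (z, Fwd) # vs) (f 0) \<longleftrightarrow>
    index_chain f (f \<circ> pinv \<sigma>) (f 0) (us @ (z, Pass) # vs) (f 0) \<and> index_chain f (f \<circ> pinv \<sigma>) (f 0) us v"
    by (auto simp: index_chain_append contraction_chain_parts contraction_values
        simp del: fun_upd_apply dest: index_chain_unique)
next
  fix f assume f: "f \<in> PiE (insert 0 (fst ` set (us @ (z, Pass) # vs))) (\<lambda>_. {..<d})"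
    and "index_chain f (f \<circ> pinv \<sigma>) (f 0) (us @ (z, Pass) # vs) (f 0)"
  then obtain m where m: "index_chain f (f \<circ> pinv \<sigma>) (f 0) us m"
    by (auto simp: index_chain_append)
  have fD: "f w \<in> {..<d}" if "w \<in> insert 0 (insert z (fst ` set (us @ vs)))" for w
    by (rule PiE_mem[OF f]) (use that in auto)
  have "m \<in> {..<d}"
  proof (rule index_chain_range[OF m])
    fix w assume "w \<in> fst ` set us"
    then have w: "w \<in> insert z (fst ` set (us @ vs))" by auto
    show "f w \<in> {..<d}" "(f \<circ> pinv \<sigma>) w \<in> {..<d}"
      using fD[of w] fD[of "pinv \<sigma> w"] w inv_in_labels[OF w] by auto
  qed (use fD in auto)
  then show "\<exists>!v. v \<in> {..<d} \<and> index_chain f (f \<circ> pinv \<sigma>) (f 0) us v"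
    using m index_chain_unique by blast
qed auto

text \<open>\<open>Pass\<close> equates the shared value with the surviving h-index. The chain
  leaves \<open>z\<close> with this value, as after a single \<open>Fwd\<close> letter.\<close>

lemma closed_count_contract_Pass_Fwd:
  "closed_count d (us @ (y, Pass) # (z, Fwd) # vs) (Transposition.transpose y z \<circ> \<sigma>) =
    closed_count d (us @ (z, Fwd) # vs) \<sigma>"
proof (rule closed_count_contract_determined)
  fix f :: "nat \<Rightarrow> nat" and v
  show "index_chain (f(y := v)) (f(y := v) \<circ> pinv (Transposition.transpose y z \<circ> \<sigma>)) (f 0)
      (us @ (y, Pass) # (z, Fwd) # vs) (f 0) \<longleftrightarrow>
    index_chain f (f \<circ> pinv \<sigma>) (f 0) (us @ (z, Fwd) # vs) (f 0) \<and> v = f (pinv \<sigma> z)"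
    by (auto simp: index_chain_append contraction_chain_parts contraction_values simp del: fun_upd_apply)
next
  fix f assume f: "f \<in> PiE (insert 0 (fst ` set (us @ (z, Fwd) # vs))) (\<lambda>_. {..<d})"
  have "f (pinv \<sigma> z) < d"
    using PiE_mem[OF f, of "pinv \<sigma> z"] inv_in_labels[of z] by auto
  then show "\<exists>!v. v \<in> {..<d} \<and> v = f (pinv \<sigma> z)" by auto
qed auto

end

section \<open>Column indices, which are constant on the cycles of the permutation\<close>

lemma cycle_count_fixed_point:
  assumes "\<sigma> permutes S" and "l \<notin> S" and "finite S"
  shows "cycle_count d (insert l S) \<sigma> = d * cycle_count d S \<sigma>"
proof -
  have "\<sigma> l = l" by (rule permutes_not_in) (use assms in auto)
  moreover have "\<sigma> w \<noteq> l" if "w \<in> S" for w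
    using permutes_in_image[OF assms(1), of w] that assms(2) by metis
  ultimately have "(\<forall>w\<in>insert l S. (f(l := v)) (\<sigma> w) = (f(l := v)) w) \<longleftrightarrow> (\<forall>w\<in>S. f (\<sigma> w) = f w)"
    for f :: "nat \<Rightarrow> nat" and v
    using assms(2) by auto
  then show ?thesis
    unfolding cycle_count_def
    by (intro card_PiE_insert_fibres) (use assms in auto)
qed

text \<open>The composition inserts \<open>y\<close> immediately before \<open>z\<close> into the
  cycle of \<open>z\<close>, so the column of \<open>y\<close> is that of \<open>z\<close>.\<close>

lemma cycle_count_contract:
  assumes \<sigma>: "\<sigma> permutes S" and y: "y \<notin> S" and z: "z \<in> S" and S: "finite S"
  shows "cycle_count d (insert y S) (Transposition.transpose y z \<circ> \<sigma>) = cycle_count d S \<sigma>"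
proof -
  have \<sigma>y: "\<sigma> y = y" by (rule permutes_not_in) (use \<sigma> y in auto)
  have \<sigma>S: "\<sigma> w \<in> S" if "w \<in> S" for w
    using permutes_in_image[OF \<sigma>, of w] that by metis
  have yz: "y \<noteq> z" using y z by auto
  obtain w where w: "w \<in> S" "\<sigma> w = z"
    using permutes_image[OF \<sigma>] z by (metis imageE)
  have *: "(\<forall>l\<in>insert y S. (f(y := v)) ((Transposition.transpose y z \<circ> \<sigma>) l) = (f(y := v)) l) \<longleftrightarrow>
      (\<forall>l\<in>S. f (\<sigma> l) = f l) \<and> v = f z" for f :: "nat \<Rightarrow> nat" and v
  proof
    assume L: "\<forall>l\<in>insert y S. (f(y := v)) ((Transposition.transpose y z \<circ> \<sigma>) l) = (f(y := v)) l"
    then have v: "v = f z" using \<sigma>y yz by auto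
    moreover have "f (\<sigma> l) = f l" if l: "l \<in> S" for l
    proof -
      have "(f(y := v)) (Transposition.transpose y z (\<sigma> l)) = f l" using L l y by auto
      then show ?thesis
        using v \<sigma>S[OF l] y by (cases "\<sigma> l = z"; cases "\<sigma> l = y") (auto simp: transpose_apply_other)
    qed
    ultimately show "(\<forall>l\<in>S. f (\<sigma> l) = f l) \<and> v = f z" by blast
  next
    assume R: "(\<forall>l\<in>S. f (\<sigma> l) = f l) \<and> v = f z"
    show "\<forall>l\<in>insert y S. (f(y := v)) ((Transposition.transpose y z \<circ> \<sigma>) l) = (f(y := v)) l"
    proof
      fix l assume "l \<in> insert y S"
      then consider "l = y" | "l \<in> S" "\<sigma> l = z" "l \<noteq> y" | "l \<in> S" "\<sigma> l \<noteq> z" "\<sigma> l \<noteq> y" "l \<noteq> y"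
        using \<sigma>S y by auto
      then show "(f(y := v)) ((Transposition.transpose y z \<circ> \<sigma>) l) = (f(y := v)) l"
        by cases (use R \<sigma>y yz in \<open>auto simp: transpose_apply_other\<close>)
    qed
  qed
  have "cycle_count d (insert y S) (Transposition.transpose y z \<circ> \<sigma>) = 1 * cycle_count d S \<sigma>"
    unfolding cycle_count_def
  proof (rule card_PiE_insert_fibres)
    fix f assume f: "f \<in> PiE S (\<lambda>_. {..<d})"
    have "{v \<in> {..<d}. v = f z} = {f z}" using f z by (auto simp: PiE_iff)
    then have "card {v \<in> {..<d}. v = f z} = 1" by simp
    then show "card {v \<in> {..<d}. \<forall>l\<in>insert y S. (f(y := v)) ((Transposition.transpose y z \<circ> \<sigma>) l) = (f(y := v)) l}
      = (if \<forall>l\<in>S. f (\<sigma> l) = f l then 1 else 0)"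
      unfolding * by simp
  qed (use assms in auto)
  then show ?thesis by simp
qed

text \<open>Being forced equal by all of \<open>F\<close> is an equivalence relation with classes of
  size at least two; one representative per class suffices. Each induction step removes a whole
  class, so the remaining variables keep their partners.\<close>

lemma determined_by_half:
  assumes "finite V" and "\<forall>v\<in>V. \<exists>w\<in>V. w \<noteq> v \<and> (\<forall>f\<in>F. f w = f v)"
  shows "\<exists>R\<subseteq>V. 2 * card R \<le> card V \<and> (\<forall>f\<in>F. \<forall>g\<in>F. (\<forall>r\<in>R. f r = g r) \<longrightarrow> (\<forall>v\<in>V. f v = g v))"
  using assms
proof (induction "card V" arbitrary: V rule: less_induct)
  case less
  show ?case
  proof (cases "V = {}")
    case False
    then obtain v where v: "v \<in> V" by auto
    define C where "C = {w \<in> V. \<forall>f\<in>F. f w = f v}"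
    obtain w where w: "w \<in> V" "w \<noteq> v" "\<forall>f\<in>F. f w = f v" using less.prems v by blast
    have C: "{v, w} \<subseteq> C" "C \<subseteq> V" using v w by (auto simp: C_def)
    have "card {v, w} \<le> card C" using C less.prems(1) by (meson card_mono finite_subset)
    then have C2: "2 \<le> card C" using w by simp
    have cardV: "card (V - C) + card C = card V"
      using C less.prems(1) by (metis card_Diff_subset card_mono finite_subset le_add_diff_inverse2)
    have "\<forall>v'\<in>V - C. \<exists>w'\<in>V - C. w' \<noteq> v' \<and> (\<forall>f\<in>F. f w' = f v')"
    proof
      fix v' assume v': "v' \<in> V - C"
      then obtain w' where "w' \<in> V" "w' \<noteq> v'" "\<forall>f\<in>F. f w' = f v'" using less.prems by blast
      moreover from this v' have "w' \<notin> C" unfolding C_def by force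
      ultimately show "\<exists>w'\<in>V - C. w' \<noteq> v' \<and> (\<forall>f\<in>F. f w' = f v')" by blast
    qed
    then obtain R where R: "R \<subseteq> V - C" "2 * card R \<le> card (V - C)"
      "\<forall>f\<in>F. \<forall>g\<in>F. (\<forall>r\<in>R. f r = g r) \<longrightarrow> (\<forall>v\<in>V - C. f v = g v)"
      using less.hyps[of "V - C"] less.prems(1) cardV C2 by auto
    have "card (insert v R) \<le> Suc (card R)" by (rule card_insert_le_m1) auto
    then have "2 * card (insert v R) \<le> card V" using R(2) cardV C2 by linarith
    moreover have "f u = g u" if fg: "f \<in> F" "g \<in> F" "\<forall>r\<in>insert v R. f r = g r" and u: "u \<in> V" for f g u
    proof (cases "u \<in> C")
      case True
      then have "f u = f v" "g u = g v" using fg by (auto simp: C_def)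
      then show ?thesis using fg(3) by simp
    next
      case False
      then show ?thesis using R(3) fg u by auto
    qed
    moreover have "insert v R \<subseteq> V" using R(1) v by auto
    ultimately show ?thesis by blast
  qed auto
qed

lemma card_paired_functions_le:
  fixes V :: "'b set"
  assumes V: "finite V" and d: "d > 0" and F: "F \<subseteq> PiE V (\<lambda>_. {..<d})"
    and pair: "\<And>v. v \<in> V \<Longrightarrow> \<exists>w\<in>V. w \<noteq> v \<and> (\<forall>f\<in>F. f w = f v)"
  shows "card F \<le> d ^ (card V div 2)"
proof -
  obtain R where R: "R \<subseteq> V" "2 * card R \<le> card V"
    "\<forall>f\<in>F. \<forall>g\<in>F. (\<forall>r\<in>R. f r = g r) \<longrightarrow> (\<forall>v\<in>V. f v = g v)"
    using determined_by_half[OF V, of F] pair by blast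
  have finR: "finite R" using R(1) V by (rule finite_subset)
  have "inj_on (\<lambda>f. restrict f R) F"
  proof (rule inj_onI)
    fix f g assume fg: "f \<in> F" "g \<in> F" and e: "restrict f R = restrict g R"
    have "\<forall>r\<in>R. f r = g r" using e by (metis restrict_apply')
    then have "\<forall>v\<in>V. f v = g v" using R(3) fg by blast
    then show "f = g" using fg F by (intro PiE_ext[of f V _ g]) auto
  qed
  moreover have "(\<lambda>f. restrict f R) ` F \<subseteq> PiE R (\<lambda>_. {..<d})"
    using F R(1) by (fastforce simp: PiE_iff subset_iff)
  ultimately have "card F \<le> card (PiE R (\<lambda>_. {..<d}))"
    using finR by (intro card_inj_on_le) (auto intro: finite_PiE)
  also have "\<dots> = d ^ card R" using finR by (simp add: card_PiE)
  also have "\<dots> \<le> d ^ (card V div 2)" using R(2) d by (intro power_increasing) auto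
  finally show ?thesis .
qed

section \<open>Wick's formula\<close>

text \<open>\<open>T a b m n\<close> stands for the expectation of \<open>X ^ a * Y ^ b * Z ^ m * cnj Z ^ n\<close> with
  \<open>Z = X + \<i> * Y\<close>; moving one factor at a time out of \<open>Z\<close> reduces integration by parts to
  monomials in \<open>X\<close> and \<open>Y\<close>.\<close>

locale mixed_moments =
  fixes T :: "nat \<Rightarrow> nat \<Rightarrow> nat \<Rightarrow> nat \<Rightarrow> complex"
  assumes split_left: "T a b (Suc m) n = T (Suc a) b m n + \<i> * T a (Suc b) m n"
    and split_right: "T a b m (Suc n) = T (Suc a) b m n - \<i> * T a (Suc b) m n"
    and parts_X0: "T (Suc a) b 0 0 = of_nat a / 2 * T (a - 1) b 0 0"
    and parts_Y0: "T a (Suc b) 0 0 = of_nat b / 2 * T a (b - 1) 0 0"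
    and unit: "T 0 0 0 0 = 1"
begin

text \<open>Gaussian integration by parts with variance 1/2: the right side is the expectation of
  the x-derivative, where \<open>Z\<close> and its conjugate both have derivative 1. Truncated
  exponents such as \<open>a - 1\<close> at \<open>a = 0\<close> occur with the factor 0.\<close>

lemma parts_X:
  "2 * T (Suc a) b m n = of_nat a * T (a - 1) b m n + of_nat m * T a b (m - 1) n + of_nat n * T a b m (n - 1)"
proof (induction n arbitrary: a b)
  case 0
  show ?case
  proof (induction m arbitrary: a b)
    case 0
    show ?case by (simp add: parts_X0)
  next
    case (Suc m)
    have "2 * T (Suc a) b (Suc m) 0 = 2 * T (Suc (Suc a)) b m 0 + \<i> * (2 * T (Suc a) (Suc b) m 0)"
      by (simp add: split_left algebra_simps)
    then show ?case
      unfolding Suc.IH by (cases a; cases m) (simp_all add: split_left algebra_simps)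
  qed
next
  case (Suc n)
  have "2 * T (Suc a) b m (Suc n) = 2 * T (Suc (Suc a)) b m n - \<i> * (2 * T (Suc a) (Suc b) m n)"
    by (simp add: split_right algebra_simps)
  then show ?case
    unfolding Suc.IH by (cases a; cases n) (simp_all add: split_right algebra_simps)
qed

lemma parts_Y:
  "2 * T a (Suc b) m n = of_nat b * T a (b - 1) m n + \<i> * of_nat m * T a b (m - 1) n - \<i> * of_nat n * T a b m (n - 1)"
proof (induction n arbitrary: a b)
  case 0
  show ?case
  proof (induction m arbitrary: a b)
    case 0
    show ?case by (simp add: parts_Y0)
  next
    case (Suc m)
    have "2 * T a (Suc b) (Suc m) 0 = 2 * T (Suc a) (Suc b) m 0 + \<i> * (2 * T a (Suc (Suc b)) m 0)"
      by (simp add: split_left algebra_simps)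
    then show ?case
      unfolding Suc.IH by (cases b; cases m) (simp_all add: split_left algebra_simps)
  qed
next
  case (Suc n)
  have "2 * T a (Suc b) m (Suc n) = 2 * T (Suc a) (Suc b) m n - \<i> * (2 * T a (Suc (Suc b)) m n)"
    by (simp add: split_right algebra_simps)
  then show ?case
    unfolding Suc.IH by (cases b; cases n) (simp_all add: split_right algebra_simps)
qed

text \<open>Combining the x- and y-derivatives gives twice the derivative in the conjugate variable:
  the \<open>m\<close> terms cancel and the \<open>n\<close> terms double. Hence each factor
  \<open>Z\<close> consumes one conjugated factor, in \<open>n\<close> ways.\<close>

lemma moment: "T 0 0 m n = (if m = n then fact n else 0)"
proof (induction m arbitrary: n)
  case 0
  show ?case
  proof (cases n)
    case (Suc k)
    have "2 * T 0 0 0 (Suc k) = 2 * T (Suc 0) 0 0 k - \<i> * (2 * T 0 (Suc 0) 0 k)"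
      by (simp add: split_right algebra_simps)
    then show ?thesis unfolding parts_X parts_Y by (simp add: Suc algebra_simps)
  qed (simp add: unit)
next
  case (Suc m)
  have "2 * T 0 0 (Suc m) n = 2 * T (Suc 0) 0 m n + \<i> * (2 * T 0 (Suc 0) m n)"
    by (simp add: split_left algebra_simps)
  then have "2 * T 0 0 (Suc m) n = 2 * (of_nat n * T 0 0 m (n - 1))"
    unfolding parts_X parts_Y by (simp add: algebra_simps)
  then have "T 0 0 (Suc m) n = of_nat n * T 0 0 m (n - 1)" by simp
  then show ?case by (cases n) (simp_all add: Suc.IH)
qed

end

section \<open>Moments of one complex Gaussian variable\<close>

context prob_space
begin

lemma normal_moment_recurrence:
  assumes s: "s > 0" and D: "distributed M lborel X (normal_density 0 s)"
  shows "integrable M (\<lambda>\<omega>. X \<omega> ^ k)"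
    and "expectation (\<lambda>\<omega>. X \<omega> ^ Suc k) = s\<^sup>2 * real k * expectation (\<lambda>\<omega>. X \<omega> ^ (k - 1))"
proof -
  show "integrable M (\<lambda>\<omega>. X \<omega> ^ k)"
    using integrable_normal_moment[OF s, of 0 k] distributed_integrable[OF D, of "\<lambda>x. x ^ k"] by simp
  have E: "expectation (\<lambda>\<omega>. X \<omega> ^ j) = (\<integral>x. normal_density 0 s x * x ^ j \<partial>lborel)" for j
    using distributed_integral[OF D, of "\<lambda>x. x ^ j"] by simp
  have even: "expectation (\<lambda>\<omega>. X \<omega> ^ (2 * j)) = fact (2 * j) / ((2 / s\<^sup>2) ^ j * fact j)" for j
    unfolding E using integral_normal_moment_even[OF s, of 0 j] by simp
  have odd: "expectation (\<lambda>\<omega>. X \<omega> ^ (2 * j + 1)) = 0" for j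
    unfolding E using integral_normal_moment_odd[OF s, of 0 j] by simp
  show "expectation (\<lambda>\<omega>. X \<omega> ^ Suc k) = s\<^sup>2 * real k * expectation (\<lambda>\<omega>. X \<omega> ^ (k - 1))"
  proof (cases "even k")
    case True
    then obtain j where k: "k = 2 * j" by (elim evenE)
    \<comment> \<open>Both sides contain odd moments, except for \<open>k = 0\<close>, where the
      factor \<open>k\<close> makes the right side vanish.\<close>
    show ?thesis using odd[of j] odd[of "j - 1"] k by (cases j) simp_all
  next
    case False
    then obtain j where k: "k = 2 * j + 1" by (elim oddE)
    have "expectation (\<lambda>\<omega>. X \<omega> ^ (2 * Suc j)) = s\<^sup>2 * real k * expectation (\<lambda>\<omega>. X \<omega> ^ (2 * j))"
    proof -
      have ratio: "2 * x * y * F / (A * (2 / t) * (x * G)) = t * y * (F / (A * G))"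
        if "x \<noteq> 0" "t \<noteq> 0" "A \<noteq> 0" "G \<noteq> 0" for x y F A t G :: real
        using that by (simp add: field_simps)
      have "fact (2 * Suc j) = 2 * real (Suc j) * real k * (fact (2 * j) :: real)"
        using k by (simp add: algebra_simps)
      moreover have "fact (Suc j) = real (Suc j) * (fact j :: real)" by simp
      ultimately show ?thesis
        unfolding even power_Suc2 using s by (simp only:) (rule ratio; simp)
    qed
    then show ?thesis using k by simp
  qed
qed

lemma complex_gaussian_mixed_moment:
  assumes Z: "complex_gaussian 1 Z"
  shows "integrable M (\<lambda>\<omega>. Z \<omega> ^ m * cnj (Z \<omega>) ^ n)"
    and "expectation (\<lambda>\<omega>. Z \<omega> ^ m * cnj (Z \<omega>) ^ n) = (if m = n then fact n else 0)"
proof -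
  let ?X = "\<lambda>\<omega>. Re (Z \<omega>)" and ?Y = "\<lambda>\<omega>. Im (Z \<omega>)"
  define h where "h a b m n \<omega> = of_real (?X \<omega> ^ a * ?Y \<omega> ^ b) * (Z \<omega> ^ m * cnj (Z \<omega>) ^ n)"
    for a b m n \<omega>
  define T where "T a b m n = expectation (h a b m n)" for a b m n
  have s: "sqrt (1 / 2) > (0::real)" by simp
  have DX: "distributed M lborel ?X (normal_density 0 (sqrt (1 / 2)))"
    and DY: "distributed M lborel ?Y (normal_density 0 (sqrt (1 / 2)))"
    and ind: "indep_var borel ?X borel ?Y"
    using Z by (simp_all add: complex_gaussian_def)
  note mX = normal_moment_recurrence[OF s DX] and mY = normal_moment_recurrence[OF s DY]
  have ind': "indep_var borel (\<lambda>\<omega>. ?X \<omega> ^ a) borel (\<lambda>\<omega>. ?Y \<omega> ^ b)" for a b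
    using indep_var_compose[OF ind, of "\<lambda>x. x ^ a" borel "\<lambda>x. x ^ b" borel] by (simp add: comp_def)
  have zX: "Z \<omega> = of_real (?X \<omega>) + \<i> * of_real (?Y \<omega>)" for \<omega>
    by (simp add: complex_eq_iff)
  have zY: "cnj (Z \<omega>) = of_real (?X \<omega>) - \<i> * of_real (?Y \<omega>)" for \<omega>
    by (simp add: complex_eq_iff)
  have hl: "h a b (Suc m) n = (\<lambda>\<omega>. h (Suc a) b m n \<omega> + \<i> * h a (Suc b) m n \<omega>)" for a b m n
  proof
    fix \<omega>
    have "h a b (Suc m) n \<omega> = Z \<omega> * h a b m n \<omega>" by (simp add: h_def)
    also have "\<dots> = h (Suc a) b m n \<omega> + \<i> * h a (Suc b) m n \<omega>"
      by (subst zX) (simp add: h_def algebra_simps)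
    finally show "h a b (Suc m) n \<omega> = h (Suc a) b m n \<omega> + \<i> * h a (Suc b) m n \<omega>" .
  qed
  have hr: "h a b m (Suc n) = (\<lambda>\<omega>. h (Suc a) b m n \<omega> - \<i> * h a (Suc b) m n \<omega>)" for a b m n
  proof
    fix \<omega>
    have "h a b m (Suc n) \<omega> = cnj (Z \<omega>) * h a b m n \<omega>" by (simp add: h_def)
    also have "\<dots> = h (Suc a) b m n \<omega> - \<i> * h a (Suc b) m n \<omega>"
      by (subst zY) (simp add: h_def algebra_simps)
    finally show "h a b m (Suc n) \<omega> = h (Suc a) b m n \<omega> - \<i> * h a (Suc b) m n \<omega>" .
  qed
  have h0: "h a b 0 0 = (\<lambda>\<omega>. of_real (?X \<omega> ^ a * ?Y \<omega> ^ b))" for a b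
    by (simp add: h_def fun_eq_iff)
  \<comment> \<open>Independence yields integrability of monomials in the real and imaginary part;
    \<open>hl\<close> and \<open>hr\<close> then add the factors \<open>Z\<close> and
    \<open>cnj Z\<close> one at a time.\<close>
  have i0: "integrable M (h a b 0 0)" for a b
    unfolding h0 by (intro integrable_of_real indep_var_integrable ind' mX mY)
  have "integrable M (h a b m 0)" for a b m
    by (induction m arbitrary: a b) (auto simp: i0 hl)
  then have int: "integrable M (h a b m n)" for a b m n
    by (induction n arbitrary: a b) (auto simp: hr)
  have T0: "T a b 0 0 = of_real (expectation (\<lambda>\<omega>. ?X \<omega> ^ a) * expectation (\<lambda>\<omega>. ?Y \<omega> ^ b))" for a b
    unfolding T_def h0 integral_complex_of_real
    by (subst indep_var_lebesgue_integral) (intro ind' mX mY refl)+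
  interpret mixed_moments T
  proof
    show "T a b (Suc m) n = T (Suc a) b m n + \<i> * T a (Suc b) m n" for a b m n
      unfolding T_def hl by (simp add: int)
    show "T a b m (Suc n) = T (Suc a) b m n - \<i> * T a (Suc b) m n" for a b m n
      unfolding T_def hr by (simp add: int)
    show "T (Suc a) b 0 0 = of_nat a / 2 * T (a - 1) b 0 0" for a b
      unfolding T0 mX by simp
    show "T a (Suc b) 0 0 = of_nat b / 2 * T a (b - 1) 0 0" for a b
      unfolding T0 mY by simp
    show "T 0 0 0 0 = 1" unfolding T0 by (simp add: prob_space)
  qed
  have h: "h 0 0 m n = (\<lambda>\<omega>. Z \<omega> ^ m * cnj (Z \<omega>) ^ n)" by (simp add: h_def fun_eq_iff)
  show "integrable M (\<lambda>\<omega>. Z \<omega> ^ m * cnj (Z \<omega>) ^ n)" using int[of 0 0 m n] h by simp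
  show "expectation (\<lambda>\<omega>. Z \<omega> ^ m * cnj (Z \<omega>) ^ n) = (if m = n then fact n else 0)"
    using moment[of m n] unfolding T_def h .
qed

end

text \<open>The permutations are sorted by the image \<open>b\<close> of \<open>a\<close>.
  Composition with the transposition of \<open>a\<close> and \<open>b\<close> makes \<open>a\<close>
  a fixed point, and the same transposition inside \<open>\<beta>\<close> preserves the condition on
  the other letters.\<close>

lemma card_matching_permutations_insert:
  assumes a: "a \<notin> S" and S: "finite S"
  shows "card {\<sigma>. \<sigma> permutes insert a S \<and> (\<forall>l\<in>insert a S. \<alpha> l = \<beta> (\<sigma> l))} =
    (\<Sum>b | b \<in> insert a S \<and> \<beta> b = \<alpha> a.
       card {\<sigma>. \<sigma> permutes S \<and> (\<forall>l\<in>S. \<alpha> l = (\<beta> \<circ> Transposition.transpose a b) (\<sigma> l))})"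
proof -
  let ?t = "\<lambda>b. Transposition.transpose a b"
  let ?P = "\<lambda>b. {\<sigma>. \<sigma> permutes S \<and> (\<forall>l\<in>S. \<alpha> l = (\<beta> \<circ> ?t b) (\<sigma> l))}"
  let ?B = "{b. b \<in> insert a S \<and> \<beta> b = \<alpha> a}"
  have bij: "bij_betw (\<lambda>(b, p). ?t b \<circ> p) (SIGMA b:?B. ?P b)
      {\<sigma>. \<sigma> permutes insert a S \<and> (\<forall>l\<in>insert a S. \<alpha> l = \<beta> (\<sigma> l))}"
  proof (rule bij_betwI[where g = "\<lambda>\<sigma>. (\<sigma> a, ?t (\<sigma> a) \<circ> \<sigma>)"])
    show "(\<lambda>(b, p). ?t b \<circ> p) \<in> (SIGMA b:?B. ?P b) \<rightarrow>
        {\<sigma>. \<sigma> permutes insert a S \<and> (\<forall>l\<in>insert a S. \<alpha> l = \<beta> (\<sigma> l))}"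
    proof clarify
      fix b p assume b: "b \<in> insert a S" "\<beta> b = \<alpha> a" and p: "p permutes S"
        and eq: "\<forall>l\<in>S. \<alpha> l = (\<beta> \<circ> ?t b) (p l)"
      have "?t b \<circ> p permutes insert a S"
        using b p by (intro permutes_compose permutes_swap_id) (auto intro: permutes_imp_permutes_insert)
      moreover have "p a = a" using p a by (rule permutes_not_in)
      ultimately show "?t b \<circ> p permutes insert a S \<and> (\<forall>l\<in>insert a S. \<alpha> l = \<beta> ((?t b \<circ> p) l))"
        using b eq by auto
    qed
    show "(\<lambda>\<sigma>. (\<sigma> a, ?t (\<sigma> a) \<circ> \<sigma>)) \<in>
        {\<sigma>. \<sigma> permutes insert a S \<and> (\<forall>l\<in>insert a S. \<alpha> l = \<beta> (\<sigma> l))} \<rightarrow> (SIGMA b:?B. ?P b)"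
    proof (rule Pi_I)
      fix \<sigma> assume "\<sigma> \<in> {\<sigma>. \<sigma> permutes insert a S \<and> (\<forall>l\<in>insert a S. \<alpha> l = \<beta> (\<sigma> l))}"
      then have p: "\<sigma> permutes insert a S" and eq: "\<forall>l\<in>insert a S. \<alpha> l = \<beta> (\<sigma> l)" by auto
      have "\<sigma> a \<in> insert a S" using permutes_in_image[OF p, of a] by simp
      then show "(\<sigma> a, ?t (\<sigma> a) \<circ> \<sigma>) \<in> (SIGMA b:?B. ?P b)"
        using permutes_insert_lemma[OF p] eq by simp
    qed
  next
    fix x assume "x \<in> (SIGMA b:?B. ?P b)"
    then obtain b p where x: "x = (b, p)" "p permutes S" by auto
    then have "p a = a" using a by (metis permutes_not_in)
    then show "(\<lambda>\<sigma>. (\<sigma> a, ?t (\<sigma> a) \<circ> \<sigma>)) ((\<lambda>(b, p). ?t b \<circ> p) x) = x"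
      using x by (simp add: fun_eq_iff)
  next
    fix \<sigma> show "(\<lambda>(b, p). ?t b \<circ> p) ((\<lambda>\<sigma>. (\<sigma> a, ?t (\<sigma> a) \<circ> \<sigma>)) \<sigma>) = \<sigma>"
      by (simp add: fun_eq_iff)
  qed
  have "finite (?P b)" for b
    by (rule finite_subset[OF _ finite_permutations[OF S]]) auto
  note finite = this
  from bij_betw_same_card[OF bij]
  have "card {\<sigma>. \<sigma> permutes insert a S \<and> (\<forall>l\<in>insert a S. \<alpha> l = \<beta> (\<sigma> l))} =
      card (SIGMA b:?B. ?P b)"
    by (rule sym)
  also have "\<dots> = (\<Sum>b\<in>?B. card (?P b))"
    by (rule card_SigmaI) (use S finite in simp_all)
  finally show ?thesis .
qed

text \<open>Both sides obey one recursion: \<open>a\<close> has as many possible images as its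
  target class under \<open>\<beta>\<close> has elements, and choosing one lowers the
  \<open>\<alpha>\<close>-count and the \<open>\<beta>\<close>-count of this class by one.\<close>

lemma card_matching_permutations:
  fixes \<alpha> \<beta> :: "'a \<Rightarrow> 'b"
  assumes "finite S" and "finite I" and "\<alpha> ` S \<subseteq> I"
  shows "card {\<sigma>. \<sigma> permutes S \<and> (\<forall>l\<in>S. \<alpha> l = \<beta> (\<sigma> l))} =
    (\<Prod>\<iota>\<in>I. if card {l \<in> S. \<alpha> l = \<iota>} = card {l \<in> S. \<beta> l = \<iota>} then fact (card {l \<in> S. \<beta> l = \<iota>}) else 0)"
  using assms
proof (induction S arbitrary: \<beta> rule: finite_induct)
  case empty
  have "{\<sigma>. \<sigma> permutes {} \<and> (\<forall>l\<in>{}. \<alpha> l = \<beta> (\<sigma> l))} = {id}" by auto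
  then show ?case by simp
next
  case (insert a S)
  define J where "J m n = (if m = n then fact n else 0 :: nat)" for m n :: nat
  let ?t = "\<lambda>b. Transposition.transpose a b"
  let ?n = "\<lambda>\<iota>. card {l \<in> insert a S. \<beta> l = \<iota>}" and ?m = "\<lambda>\<iota>. card {l \<in> S. \<alpha> l = \<iota>}"
  let ?B = "{b. b \<in> insert a S \<and> \<beta> b = \<alpha> a}"
  \<comment> \<open>After the transposition, \<open>S\<close> carries the
    \<open>\<beta>\<close>-values of \<open>insert a S\<close> without the used element
    \<open>b\<close>; if \<open>b \<noteq> a\<close>, then \<open>a\<close> has taken its
    place.\<close>
  have shifted: "card {l \<in> S. (\<beta> \<circ> ?t b) l = \<iota>} = ?n \<iota> - of_bool (\<iota> = \<alpha> a)" if b: "b \<in> ?B" for b \<iota>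
  proof -
    have "bij_betw (?t b) {l \<in> S. (\<beta> \<circ> ?t b) l = \<iota>} ({l \<in> insert a S. \<beta> l = \<iota>} - {b})"
    proof (rule bij_betwI[where g = "?t b"])
      show "?t b \<in> {l \<in> S. (\<beta> \<circ> ?t b) l = \<iota>} \<rightarrow> {l \<in> insert a S. \<beta> l = \<iota>} - {b}"
        using b insert.hyps by (auto simp: Transposition.transpose_def split: if_splits)
      show "?t b \<in> {l \<in> insert a S. \<beta> l = \<iota>} - {b} \<rightarrow> {l \<in> S. (\<beta> \<circ> ?t b) l = \<iota>}"
        using b insert.hyps by (auto simp: Transposition.transpose_def split: if_splits)
    qed simp_all
    then have "card {l \<in> S. (\<beta> \<circ> ?t b) l = \<iota>} = card ({l \<in> insert a S. \<beta> l = \<iota>} - {b})"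
      by (rule bij_betw_same_card)
    also have "\<dots> = ?n \<iota> - of_bool (\<iota> = \<alpha> a)"
      using b insert.hyps by (auto simp: card_Diff_singleton_if)
    finally show ?thesis .
  qed
  have J: "J (Suc m) n = n * J m (n - 1)" for m n by (cases n) (auto simp: J_def)
  have aI: "\<alpha> a \<in> I" using insert.prems by auto
  have m': "card {l \<in> insert a S. \<alpha> l = \<iota>} = ?m \<iota> + of_bool (\<iota> = \<alpha> a)" for \<iota>
  proof -
    have "{l \<in> insert a S. \<alpha> l = \<iota>} = (if \<iota> = \<alpha> a then insert a {l \<in> S. \<alpha> l = \<iota>} else {l \<in> S. \<alpha> l = \<iota>})"
      by auto
    then show ?thesis using insert.hyps by simp
  qed
  have "card {\<sigma>. \<sigma> permutes insert a S \<and> (\<forall>l\<in>insert a S. \<alpha> l = \<beta> (\<sigma> l))} =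
      (\<Sum>b\<in>?B. card {\<sigma>. \<sigma> permutes S \<and> (\<forall>l\<in>S. \<alpha> l = (\<beta> \<circ> ?t b) (\<sigma> l))})"
    by (rule card_matching_permutations_insert) (use insert.hyps in auto)
  also have "\<dots> = (\<Sum>b\<in>?B. \<Prod>\<iota>\<in>I. J (?m \<iota>) (card {l \<in> S. (\<beta> \<circ> ?t b) l = \<iota>}))"
    unfolding J_def using insert.prems by (intro sum.cong refl insert.IH) auto
  also have "\<dots> = (\<Sum>b\<in>?B. \<Prod>\<iota>\<in>I. J (?m \<iota>) (?n \<iota> - of_bool (\<iota> = \<alpha> a)))"
    using shifted by (intro sum.cong prod.cong refl) simp
  also have "\<dots> = ?n (\<alpha> a) * (\<Prod>\<iota>\<in>I. J (?m \<iota>) (?n \<iota> - of_bool (\<iota> = \<alpha> a)))" by simp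
  also have "\<dots> = (\<Prod>\<iota>\<in>I. J (?m \<iota> + of_bool (\<iota> = \<alpha> a)) (?n \<iota>))"
    using insert.prems(1) aI by (simp add: prod.remove[of I "\<alpha> a"] J)
  finally show ?case unfolding m' J_def .
qed

text \<open>Collecting equal variables yields independent powers. A mixed moment counts the
  bijections between the plain and the conjugated occurrences of its variable, and a matching
  permutation is a choice of one such bijection for every variable.\<close>

lemma (in prob_space) wick_formula:
  fixes Z :: "'i \<Rightarrow> 'a \<Rightarrow> complex" and \<alpha> \<beta> :: "'l \<Rightarrow> 'i"
  assumes I: "finite I" and ind: "indep_vars (\<lambda>_. borel) Z I"
    and Z: "\<And>\<iota>. \<iota> \<in> I \<Longrightarrow> complex_gaussian 1 (Z \<iota>)"
    and S: "finite S" and \<alpha>: "\<alpha> ` S \<subseteq> I" and \<beta>: "\<beta> ` S \<subseteq> I"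
  shows "integrable M (\<lambda>\<omega>. \<Prod>l\<in>S. Z (\<alpha> l) \<omega> * cnj (Z (\<beta> l) \<omega>))"
    and "expectation (\<lambda>\<omega>. \<Prod>l\<in>S. Z (\<alpha> l) \<omega> * cnj (Z (\<beta> l) \<omega>)) =
      of_nat (card {\<sigma>. \<sigma> permutes S \<and> (\<forall>l\<in>S. \<alpha> l = \<beta> (\<sigma> l))})"
proof -
  let ?m = "\<lambda>\<iota>. card {l \<in> S. \<alpha> l = \<iota>}" and ?n = "\<lambda>\<iota>. card {l \<in> S. \<beta> l = \<iota>}"
  let ?Y = "\<lambda>\<iota> \<omega>. Z \<iota> \<omega> ^ ?m \<iota> * cnj (Z \<iota> \<omega>) ^ ?n \<iota>"
  have group: "(\<Prod>\<iota>\<in>I. f \<iota> ^ card {l \<in> S. \<gamma> l = \<iota>}) = (\<Prod>l\<in>S. f (\<gamma> l))"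
    if "\<gamma> ` S \<subseteq> I" for f :: "'i \<Rightarrow> complex" and \<gamma> :: "'l \<Rightarrow> 'i"
    using prod.group[OF S I that, of "\<lambda>l. f (\<gamma> l)"] by simp
  have eq: "(\<lambda>\<omega>. \<Prod>l\<in>S. Z (\<alpha> l) \<omega> * cnj (Z (\<beta> l) \<omega>)) = (\<lambda>\<omega>. \<Prod>\<iota>\<in>I. ?Y \<iota> \<omega>)"
    unfolding prod.distrib
    by (simp add: group[OF \<alpha>, of "\<lambda>\<iota>. Z \<iota> _"] group[OF \<beta>, of "\<lambda>\<iota>. cnj (Z \<iota> _)"])
  have ind': "indep_vars (\<lambda>_. borel) ?Y I"
    by (rule indep_vars_compose2[OF ind]) (intro borel_measurable_continuous_onI continuous_intros)
  note Y = complex_gaussian_mixed_moment[OF Z]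
  show "integrable M (\<lambda>\<omega>. \<Prod>l\<in>S. Z (\<alpha> l) \<omega> * cnj (Z (\<beta> l) \<omega>))"
    unfolding eq by (rule indep_vars_integrable[OF I ind']) (rule Y)
  have "expectation (\<lambda>\<omega>. \<Prod>\<iota>\<in>I. ?Y \<iota> \<omega>) = (\<Prod>\<iota>\<in>I. if ?m \<iota> = ?n \<iota> then fact (?n \<iota>) else 0)"
    by (subst indep_vars_lebesgue_integral[OF I ind']) (auto simp: Y intro!: prod.cong)
  also have "\<dots> = of_nat (card {\<sigma>. \<sigma> permutes S \<and> (\<forall>l\<in>S. \<alpha> l = \<beta> (\<sigma> l))})"
    unfolding card_matching_permutations[OF S I \<alpha>] of_nat_prod by (intro prod.cong) auto
  finally show "expectation (\<lambda>\<omega>. \<Prod>l\<in>S. Z (\<alpha> l) \<omega> * cnj (Z (\<beta> l) \<omega>)) =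
      of_nat (card {\<sigma>. \<sigma> permutes S \<and> (\<forall>l\<in>S. \<alpha> l = \<beta> (\<sigma> l))})"
    unfolding eq .
qed

section \<open>Reduction of words\<close>

text \<open>
  A block \<open>(l, c, m)\<close> is the result of merging \<open>m\<close> letters of kind \<open>c\<close> (\<open>True\<close> for the Wishart
  matrix, \<open>False\<close> for its partial transpose). Partial transposition reverses the inner index only.
  For the block index, two merged transposed letters contract their outer indices with each other, so
  that a block of even size passes the block index through; this is why parity matters.
\<close>

type_synonym block = "nat \<times> bool \<times> nat"

fun small_dir :: "block \<Rightarrow> nat \<times> direction" where
  "small_dir (l, c, m) = (l, if c \<or> odd m then Fwd else Pass)"

fun large_dir :: "block \<Rightarrow> nat \<times> direction" where
  "large_dir (l, c, m) = (l, if c then Fwd else Bwd)"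

fun contracts :: "(nat \<Rightarrow> nat) \<Rightarrow> block \<Rightarrow> block \<Rightarrow> bool" where
  "contracts \<sigma> (l, c, m) (l', c', m') \<longleftrightarrow> c = c' \<and> (if c then \<sigma> l' = l else \<sigma> l = l')"

text \<open>The block keeps the label of its surviving unconjugated factor. This factor lies in the
  left block for the Wishart kind and in the right one for the transposed kind.\<close>

fun merged :: "block \<Rightarrow> block \<Rightarrow> block" where
  "merged (l, c, m) (l', c', m') = (if c then l else l', c, Suc m)"

definition top_open :: "(nat \<Rightarrow> nat) \<Rightarrow> block \<Rightarrow> block list \<Rightarrow> bool" where
  "top_open \<sigma> s u \<longleftrightarrow> (case u of [] \<Rightarrow> True | t # _ \<Rightarrow> \<not> contracts \<sigma> t s)"

text \<open>The reading so far left nothing undone: no stack block is paired with itself, nor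
  contractibly with the block below it. Pairings with unread letters are unrestricted.\<close>

fun reduced :: "(nat \<Rightarrow> nat) \<Rightarrow> block list \<Rightarrow> bool" where
  "reduced \<sigma> [] \<longleftrightarrow> True"
| "reduced \<sigma> (s # u) \<longleftrightarrow> \<sigma> (fst s) \<noteq> fst s \<and> top_open \<sigma> s u \<and> reduced \<sigma> u"

definition labels :: "block list \<Rightarrow> nat set" where
  "labels xs = fst ` set xs"

definition labelled :: "block list \<Rightarrow> bool" where
  "labelled xs \<longleftrightarrow> distinct (map fst xs) \<and> 0 \<notin> labels xs"

lemma labels_simps [simp]: "labels [] = {}" "labels (x # xs) = insert (fst x) (labels xs)"
  "labels (xs @ ys) = labels xs \<union> labels ys" "labels (rev xs) = labels xs"
  by (auto simp: labels_def)

lemma finite_labels [simp]: "finite (labels xs)"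
  by (simp add: labels_def)

lemma fst_dir [simp]: "fst (small_dir b) = fst b" "fst (large_dir b) = fst b"
  by (cases b; simp)+

lemma fst_set_map_dir [simp]:
  "fst ` set (map small_dir xs) = labels xs" "fst ` set (map large_dir xs) = labels xs"
  by (auto simp: labels_def image_image)

lemma labelled_simps: "labelled (us @ s # vs) \<longleftrightarrow> labelled (us @ vs) \<and> fst s \<noteq> 0 \<and> fst s \<notin> labels (us @ vs)"
  by (auto simp: labelled_def labels_def)

text \<open>The three counts concern columns, inner indices and block indices. Every letter is
  normalised by \<open>d1 * d2\<close>, and the trace contributes one further factor.\<close>

definition block_weight :: "nat \<Rightarrow> nat \<Rightarrow> nat \<Rightarrow> block list \<Rightarrow> (nat \<Rightarrow> nat) \<Rightarrow> complex" where
  "block_weight d1 d2 p xs \<sigma> =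
     of_nat (cycle_count p (labels xs) \<sigma> * closed_count d2 (map large_dir xs) \<sigma> *
       closed_count d1 (map small_dir xs) \<sigma>) / of_nat (d1 * d2) ^ Suc (length xs)"

definition close_weight :: "nat \<Rightarrow> complex \<Rightarrow> bool \<times> nat \<Rightarrow> complex" where
  "close_weight d1 r = (\<lambda>(c, m). r * (if c \<or> odd m then 1 else of_nat d1))"

definition merge_weight :: "nat \<Rightarrow> bool \<Rightarrow> complex" where
  "merge_weight d1 c = (if c then 1 else 1 / of_nat d1)"

section \<open>The price of closing or merging a block\<close>

lemma block_weight_fixed_point:
  assumes d: "d1 > 0" "d2 > 0" and \<sigma>: "\<sigma> permutes labels (us @ vs)" and l: "labelled (us @ s # vs)"
  shows "block_weight d1 d2 p (us @ s # vs) \<sigma> =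
    close_weight d1 (of_nat p / of_nat (d1 * d2)) (snd s) * block_weight d1 d2 p (us @ vs) \<sigma>"
proof -
  obtain a c m where s: "s = (a, c, m)" by (cases s)
  have a: "a \<notin> labels (us @ vs)" "a \<noteq> 0" "0 \<notin> labels (us @ vs)"
    using l by (auto simp: s labelled_def labels_def)
  have lab: "fst ` set (map small_dir us @ map small_dir vs) = labels (us @ vs)"
      "fst ` set (map large_dir us @ map large_dir vs) = labels (us @ vs)"
    by (simp_all flip: map_append del: set_map)
  have "labels (us @ s # vs) = insert a (labels (us @ vs))" by (simp add: s)
  then have K: "cycle_count p (labels (us @ s # vs)) \<sigma> = p * cycle_count p (labels (us @ vs)) \<sigma>"
    using cycle_count_fixed_point[OF \<sigma> a(1)] by simp
  have A: "closed_count d2 (map large_dir (us @ s # vs)) \<sigma> = closed_count d2 (map large_dir (us @ vs)) \<sigma>"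
    using closed_count_fixed_point[of \<sigma> "map large_dir us" "map large_dir vs" a d2] \<sigma> a
    unfolding lab by (simp add: s)
  have I: "closed_count d1 (map small_dir (us @ s # vs)) \<sigma> =
      (if c \<or> odd m then 1 else d1) * closed_count d1 (map small_dir (us @ vs)) \<sigma>"
    using closed_count_fixed_point[of \<sigma> "map small_dir us" "map small_dir vs" a d1] \<sigma> a
    unfolding lab by (simp add: s)
  show ?thesis
    unfolding block_weight_def K A I close_weight_def by (simp add: s)
qed

text \<open>The word gets shorter by one letter, which costs one factor \<open>d1 * d2\<close>. A
  Wishart pair frees an inner and a block index and pays this fully. A transposed pair frees only
  the inner index: its block index alternates between \<open>Fwd\<close> and \<open>Pass\<close>
  with the parity of \<open>m\<close> and gains nothing.\<close>

lemma block_weight_merge: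
  assumes d: "d1 > 0" "d2 > 0"
    and t: "t = (lt, c, m)" and s: "s = (ls, c, 1)"
    and yz: "y = (if c then ls else lt)" "z = (if c then lt else ls)"
    and \<sigma>: "\<sigma> permutes labels (us @ merged t s # vs)" and l: "labelled (us @ t # s # vs)"
  shows "block_weight d1 d2 p (us @ t # s # vs) (Transposition.transpose y z \<circ> \<sigma>) =
    merge_weight d1 c * block_weight d1 d2 p (us @ merged t s # vs) \<sigma>"
proof -
  have lts: "lt \<notin> labels (us @ vs)" "ls \<notin> labels (us @ vs)" "lt \<noteq> ls" "lt \<noteq> 0" "ls \<noteq> 0" "0 \<notin> labels (us @ vs)"
    using l by (auto simp: s t labelled_def labels_def)
  have lab: "fst ` set (map small_dir us @ map small_dir vs) = labels (us @ vs)"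
      "fst ` set (map large_dir us @ map large_dir vs) = labels (us @ vs)"
    by (simp_all flip: map_append del: set_map)
  have labm: "labels (us @ merged t s # vs) = insert z (labels (us @ vs))"
    by (simp add: s t yz)
  have perm: "\<sigma> permutes insert z (labels (us @ vs))" using \<sigma> unfolding labm .
  have labts: "labels (us @ t # s # vs) = insert y (insert z (labels (us @ vs)))" by (auto simp: s t yz)
  have K: "cycle_count p (labels (us @ t # s # vs)) (Transposition.transpose y z \<circ> \<sigma>) =
      cycle_count p (labels (us @ merged t s # vs)) \<sigma>"
    unfolding labts labm by (rule cycle_count_contract[OF perm]) (use lts yz in auto)
  show ?thesis
  proof (cases c)
    case True
    have A: "closed_count d2 (map large_dir (us @ t # s # vs)) (Transposition.transpose y z \<circ> \<sigma>) =
        d2 * closed_count d2 (map large_dir (us @ merged t s # vs)) \<sigma>"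
      using closed_count_contract_Fwd[of \<sigma> z "map large_dir us" "map large_dir vs" y d2] perm lts yz
      unfolding lab by (simp add: s t True)
    have I: "closed_count d1 (map small_dir (us @ t # s # vs)) (Transposition.transpose y z \<circ> \<sigma>) =
        d1 * closed_count d1 (map small_dir (us @ merged t s # vs)) \<sigma>"
      using closed_count_contract_Fwd[of \<sigma> z "map small_dir us" "map small_dir vs" y d1] perm lts yz
      unfolding lab by (simp add: s t True)
    show ?thesis
      unfolding block_weight_def K A I merge_weight_def using d True by (simp add: field_simps)
  next
    case False
    have A: "closed_count d2 (map large_dir (us @ t # s # vs)) (Transposition.transpose y z \<circ> \<sigma>) =
        d2 * closed_count d2 (map large_dir (us @ merged t s # vs)) \<sigma>"
      using closed_count_contract_Bwd[of \<sigma> z "map large_dir us" "map large_dir vs" y d2] perm lts yz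
      unfolding lab by (simp add: s t False)
    have I: "closed_count d1 (map small_dir (us @ t # s # vs)) (Transposition.transpose y z \<circ> \<sigma>) =
        closed_count d1 (map small_dir (us @ merged t s # vs)) \<sigma>"
      using closed_count_contract_Fwd_Fwd[of \<sigma> z "map small_dir us" "map small_dir vs" y d1]
        closed_count_contract_Pass_Fwd[of \<sigma> z "map small_dir us" "map small_dir vs" y d1] perm lts yz
      unfolding lab by (cases "odd m") (simp_all add: s t False)
    show ?thesis
      unfolding block_weight_def K A I merge_weight_def using d False by (simp add: field_simps)
  qed
qed

text \<open>The stack lists its top first, so \<open>rev u @ v\<close> is the word in reading order,
  with \<open>v\<close> still unread.\<close>

definition stack_sum :: "nat \<Rightarrow> nat \<Rightarrow> nat \<Rightarrow> block list \<Rightarrow> block list \<Rightarrow> complex" where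
  "stack_sum d1 d2 p u v =
     (\<Sum>\<sigma> | \<sigma> permutes labels (rev u @ v) \<and> reduced \<sigma> u. block_weight d1 d2 p (rev u @ v) \<sigma>)"

text \<open>An intermediate stage: \<open>s\<close> cannot merge with the stack any more, but
  whether it is closed or stays open is still undecided.\<close>

definition pending_sum :: "nat \<Rightarrow> nat \<Rightarrow> nat \<Rightarrow> block list \<Rightarrow> block \<Rightarrow> block list \<Rightarrow> complex" where
  "pending_sum d1 d2 p u s v =
     (\<Sum>\<sigma> | \<sigma> permutes labels (rev u @ s # v) \<and> reduced \<sigma> u \<and> top_open \<sigma> s u.
        block_weight d1 d2 p (rev u @ s # v) \<sigma>)"

lemma finite_permuting [simp]: "finite S \<Longrightarrow> finite {\<sigma>. \<sigma> permutes S \<and> P \<sigma>}"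
  by (rule finite_subset[OF _ finite_permutations]) auto

text \<open>A contraction would give \<open>s\<close> a second image or a second preimage. Closing a
  block is therefore compatible with the priority of merging.\<close>

lemma top_open_fixed_point:
  assumes "\<sigma> permutes S" and "\<sigma> (fst s) = fst s" and "fst s \<notin> labels u"
  shows "top_open \<sigma> s u"
proof (cases u)
  case (Cons t u')
  have "inj \<sigma>" using assms(1) by (rule permutes_inj)
  then have "\<not> contracts \<sigma> t s"
    using assms Cons by (cases s; cases t) (auto simp: inj_eq dest: injD)
  then show ?thesis by (simp add: top_open_def Cons)
qed (simp add: top_open_def)

text \<open>Permutations fixing the label of \<open>s\<close> are the permutations of the remaining
  labels, which closes the block; all others leave it open on the stack.\<close>

lemma pending_sum_rec:
  assumes d: "d1 > 0" "d2 > 0" and l: "labelled (rev u @ s # v)"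
  shows "pending_sum d1 d2 p u s v =
    close_weight d1 (of_nat p / of_nat (d1 * d2)) (snd s) * stack_sum d1 d2 p u v + stack_sum d1 d2 p (s # u) v"
proof -
  let ?S = "labels (rev u @ s # v)" and ?S' = "labels (rev u @ v)"
  let ?w = "block_weight d1 d2 p (rev u @ s # v)"
  have s: "fst s \<notin> ?S'" using l by (simp add: labelled_simps)
  have ins: "?S = insert (fst s) ?S'" by simp
  have fixed: "\<sigma> permutes ?S \<and> \<sigma> (fst s) = fst s \<longleftrightarrow> \<sigma> permutes ?S'" for \<sigma>
  proof
    assume "\<sigma> permutes ?S'"
    then show "\<sigma> permutes ?S \<and> \<sigma> (fst s) = fst s"
      using s permutes_not_in unfolding ins by (metis permutes_imp_permutes_insert)
  next
    assume "\<sigma> permutes ?S \<and> \<sigma> (fst s) = fst s"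
    then show "\<sigma> permutes ?S'"
      unfolding ins by (elim conjE permutes_superset) auto
  qed
  have split: "{\<sigma>. \<sigma> permutes ?S \<and> reduced \<sigma> u \<and> top_open \<sigma> s u} =
      {\<sigma>. \<sigma> permutes ?S' \<and> reduced \<sigma> u} \<union> {\<sigma>. \<sigma> permutes ?S \<and> reduced \<sigma> (s # u)}" (is "_ = ?A \<union> ?B")
  proof -
    have "top_open \<sigma> s u" if "\<sigma> permutes ?S'" for \<sigma>
      using top_open_fixed_point[of \<sigma> ?S' s u] that fixed[of \<sigma>] s by simp
    then show ?thesis using fixed by (auto simp del: labels_simps)
  qed
  have "pending_sum d1 d2 p u s v = sum ?w ?A + sum ?w ?B"
    unfolding pending_sum_def split
    by (rule sum.union_disjoint) (use fixed in \<open>auto simp del: labels_simps\<close>)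
  also have "sum ?w ?A =
      close_weight d1 (of_nat p / of_nat (d1 * d2)) (snd s) * stack_sum d1 d2 p u v"
    unfolding stack_sum_def sum_distrib_left
    by (rule sum.cong[OF refl]) (use block_weight_fixed_point[OF d _ l] in auto)
  also have "sum ?w ?B = stack_sum d1 d2 p (s # u) v"
    by (simp add: stack_sum_def)
  finally show ?thesis .
qed

lemma reduced_cong:
  assumes "\<And>l l'. l \<in> labels u \<Longrightarrow> l' \<in> labels u \<Longrightarrow> \<sigma> l = l' \<longleftrightarrow> \<tau> l = l'"
  shows "reduced \<sigma> u \<longleftrightarrow> reduced \<tau> u"
  using assms
proof (induction u)
  case (Cons s u)
  have "top_open \<sigma> s u \<longleftrightarrow> top_open \<tau> s u"
  proof (cases u)
    case (Cons t u')
    then show ?thesis using Cons.prems by (cases s; cases t) (auto simp: top_open_def)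
  qed (simp add: top_open_def)
  then show ?case using Cons by auto
qed simp

text \<open>Composition with one transposition matches the permutations contracting \<open>t\<close>
  with \<open>s\<close> to those of the merged word. The stack conditions carry over:
  \<open>t\<close> could not merge with the block below, and this says the same of the merged
  block.\<close>

lemma stack_sum_rec_merge:
  assumes d: "d1 > 0" "d2 > 0" and t: "t = (lt, c, m)" and s: "s = (ls, c, 1)"
    and l: "labelled (rev (t # u) @ s # v)"
  shows "(\<Sum>\<sigma> | \<sigma> permutes labels (rev (t # u) @ s # v) \<and> reduced \<sigma> (t # u) \<and> contracts \<sigma> t s.
      block_weight d1 d2 p (rev (t # u) @ s # v) \<sigma>) =
    merge_weight d1 c * pending_sum d1 d2 p u (merged t s) v"
proof -
  define y z where yz: "y = (if c then ls else lt)" "z = (if c then lt else ls)"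
  let ?\<tau> = "Transposition.transpose y z"
  let ?S = "labels (rev (t # u) @ s # v)" and ?S' = "labels (rev u @ merged t s # v)"
  let ?A = "{\<sigma>. \<sigma> permutes ?S' \<and> reduced \<sigma> u \<and> top_open \<sigma> (merged t s) u}"
  let ?B = "{\<sigma>. \<sigma> permutes ?S \<and> reduced \<sigma> (t # u) \<and> contracts \<sigma> t s}"
  have l': "labelled (rev u @ t # s # v)" using l by simp
  have lts: "lt \<notin> labels (u @ v)" "ls \<notin> labels (u @ v)" "lt \<noteq> ls"
    using l' by (auto simp: s t labelled_def labels_def)
  have S: "?S = insert y ?S'" "y \<notin> ?S'" "z \<in> ?S'"
    using lts by (auto simp: s t yz)
  have contr: "contracts \<sigma> t s \<longleftrightarrow> \<sigma> y = z" for \<sigma> by (auto simp: s t yz)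
  have invol: "?\<tau> \<circ> (?\<tau> \<circ> \<sigma>) = \<sigma>" for \<sigma> :: "nat \<Rightarrow> nat" by (simp add: fun_eq_iff)
  have fwd: "(?\<tau> \<circ> \<sigma>) permutes ?S" if "\<sigma> permutes ?S'" for \<sigma>
    using that S by (intro permutes_compose permutes_swap_id) (auto intro: permutes_imp_permutes_insert)
  have bwd: "(?\<tau> \<circ> \<sigma>) permutes ?S'" if "\<sigma> permutes ?S" "\<sigma> y = z" for \<sigma>
    using permutes_insert_lemma[of \<sigma> y ?S'] that S by simp
  have cond: "reduced (?\<tau> \<circ> \<sigma>) (t # u) \<and> contracts (?\<tau> \<circ> \<sigma>) t s \<longleftrightarrow>
      reduced \<sigma> u \<and> top_open \<sigma> (merged t s) u" if \<sigma>: "\<sigma> permutes ?S'" for \<sigma>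
  proof -
    have \<sigma>y: "\<sigma> y = y" using \<sigma> S by (simp add: permutes_not_in)
    have \<sigma>S: "\<sigma> w \<noteq> y" if "w \<noteq> y" for w
      using \<sigma>y that permutes_inj[OF \<sigma>] by (metis injD)
    have nyz: "l \<noteq> y \<and> l \<noteq> z" if "l \<in> labels u" for l using that lts by (auto simp: yz)
    have key: "?\<tau> (\<sigma> l) = l' \<longleftrightarrow> \<sigma> l = l'" if "l' \<noteq> y" "l' \<noteq> z" for l l'
      using that by (auto simp: Transposition.transpose_def)
    have 1: "reduced (?\<tau> \<circ> \<sigma>) u \<longleftrightarrow> reduced \<sigma> u"
      by (rule reduced_cong) (use key nyz in auto)
    have 2: "contracts (?\<tau> \<circ> \<sigma>) t s" by (simp add: contr \<sigma>y)
    \<comment> \<open>In the Wishart case \<open>lt\<close> is the image of \<open>ls\<close>, in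
      the transposed case it is sent to \<open>ls\<close>; either way it is not fixed.\<close>
    have 3: "(?\<tau> \<circ> \<sigma>) lt \<noteq> lt"
      using \<sigma>y \<sigma>S[of lt] lts by (auto simp: yz Transposition.transpose_def split: if_splits)
    have 4: "top_open (?\<tau> \<circ> \<sigma>) t u \<longleftrightarrow> top_open \<sigma> (merged t s) u"
    proof (cases u)
      case (Cons t' u')
      obtain l'' c'' m'' where t': "t' = (l'', c'', m'')" by (cases t')
      have n: "l'' \<noteq> y" "l'' \<noteq> z" using nyz[of l''] Cons t' by auto
      show ?thesis
      proof (cases c)
        case True
        then show ?thesis using key[OF n, of lt] by (auto simp: top_open_def Cons t' s t)
      next
        case False
        \<comment> \<open>The transposed block continues under the label \<open>ls\<close>, so a
          pairing of the lower block with \<open>lt\<close> before merging corresponds to one with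
          \<open>ls\<close> afterwards.\<close>
        have "?\<tau> (\<sigma> l'') = y \<longleftrightarrow> \<sigma> l'' = z"
          using \<sigma>S[OF n(1)] by (auto simp: Transposition.transpose_def)
        then show ?thesis using False by (auto simp: top_open_def Cons t' s t yz)
      qed
    qed (simp add: top_open_def)
    show ?thesis using 1 2 3 4 unfolding reduced.simps t fst_conv by blast
  qed
  have "sum (block_weight d1 d2 p (rev (t # u) @ s # v)) ?B =
      (\<Sum>\<sigma>\<in>?A. block_weight d1 d2 p (rev (t # u) @ s # v) (?\<tau> \<circ> \<sigma>))"
  proof (rule sum.reindex_bij_witness[where i = "\<lambda>\<sigma>. ?\<tau> \<circ> \<sigma>" and j = "\<lambda>\<sigma>. ?\<tau> \<circ> \<sigma>"])
    fix \<sigma> assume \<sigma>: "\<sigma> \<in> ?B"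
    then have "\<sigma> permutes ?S" "\<sigma> y = z" using contr by blast+
    then have "?\<tau> \<circ> \<sigma> permutes ?S'" by (rule bwd)
    then show "?\<tau> \<circ> \<sigma> \<in> ?A"
      using \<sigma> cond[of "?\<tau> \<circ> \<sigma>"] unfolding invol mem_Collect_eq by blast
  next
    fix \<sigma> assume \<sigma>: "\<sigma> \<in> ?A"
    then have "\<sigma> permutes ?S'" by blast
    then show "?\<tau> \<circ> \<sigma> \<in> ?B" using \<sigma> cond[of \<sigma>] fwd[of \<sigma>] unfolding mem_Collect_eq by blast
  qed (simp_all only: invol)
  also have "\<dots> = (\<Sum>\<sigma>\<in>?A. merge_weight d1 c * block_weight d1 d2 p (rev u @ merged t s # v) \<sigma>)"
  proof (rule sum.cong[OF refl])
    fix \<sigma> assume "\<sigma> \<in> ?A"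
    then have "\<sigma> permutes ?S'" by blast
    then show "block_weight d1 d2 p (rev (t # u) @ s # v) (?\<tau> \<circ> \<sigma>) =
        merge_weight d1 c * block_weight d1 d2 p (rev u @ merged t s # v) \<sigma>"
      using block_weight_merge[OF d t s yz, of \<sigma> "rev u" v p] l' by simp
  qed
  finally show ?thesis by (simp add: pending_sum_def sum_distrib_left)
qed

lemma stack_sum_rec:
  assumes d: "d1 > 0" "d2 > 0" and l: "labelled (rev u @ (a, c, 1) # v)"
  shows "stack_sum d1 d2 p u ((a, c, 1) # v) = pending_sum d1 d2 p u (a, c, 1) v +
    (case u of [] \<Rightarrow> 0 | t # u' \<Rightarrow> if fst (snd t) = c
       then merge_weight d1 c * pending_sum d1 d2 p u' (merged t (a, c, 1)) v else 0)"
proof -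
  let ?s = "(a, c, 1) :: block"
  let ?w = "block_weight d1 d2 p (rev u @ ?s # v)"
  let ?A = "{\<sigma>. \<sigma> permutes labels (rev u @ ?s # v) \<and> reduced \<sigma> u \<and> top_open \<sigma> ?s u}"
  let ?B = "{\<sigma>. \<sigma> permutes labels (rev u @ ?s # v) \<and> reduced \<sigma> u \<and> \<not> top_open \<sigma> ?s u}"
  have "stack_sum d1 d2 p u (?s # v) = sum ?w (?A \<union> ?B)"
    unfolding stack_sum_def by (rule sum.cong) auto
  also have "\<dots> = sum ?w ?A + sum ?w ?B" by (rule sum.union_disjoint) auto
  also have "sum ?w ?A = pending_sum d1 d2 p u ?s v" by (simp add: pending_sum_def)
  also have "sum ?w ?B = (case u of [] \<Rightarrow> 0 | t # u' \<Rightarrow> if fst (snd t) = c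
       then merge_weight d1 c * pending_sum d1 d2 p u' (merged t ?s) v else 0)"
  proof (cases u)
    case Nil
    then show ?thesis by (simp add: top_open_def)
  next
    case (Cons t u')
    obtain lt ct m where t: "t = (lt, ct, m)" by (cases t)
    show ?thesis
    proof (cases "ct = c")
      case True
      have "?B = {\<sigma>. \<sigma> permutes labels (rev (t # u') @ ?s # v) \<and> reduced \<sigma> (t # u') \<and> contracts \<sigma> t ?s}"
        unfolding Cons by (auto simp: top_open_def simp del: labels_simps reduced.simps contracts.simps)
      then show ?thesis
        using stack_sum_rec_merge[OF d t[unfolded True] refl, of u' a v p] l True Cons t by simp
    next
      case False
      then have "top_open \<sigma> ?s u" for \<sigma> by (simp add: Cons t top_open_def)
      then show ?thesis using False Cons t by simp
    qed
  qed
  finally show ?thesis .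
qed

section \<open>The limit of the moments\<close>

lemma index_chain_first:
  assumes "index_chain g h x ((a, k) # vs) y" and "k \<noteq> Pass"
  shows "x = (if k = Fwd then g a else h a)"
  using assms by (cases k) auto

lemma index_chain_last:
  assumes "index_chain g h x (us @ [(a, k)]) y" and "k \<noteq> Pass"
  shows "y = (if k = Fwd then h a else g a)"
  using assms by (cases k) (auto simp: index_chain_append)

lemma index_chain_adjacent:
  assumes "index_chain g h x (us @ (a, k) # (b, k') # vs) y" and "k \<noteq> Pass" "k' \<noteq> Pass"
  shows "(if k = Fwd then h a else g a) = (if k' = Fwd then g b else h b)"
  using assms by (cases k; cases k') (auto simp: index_chain_append)

lemma reduced_appendD: "reduced \<sigma> (u @ v) \<Longrightarrow> reduced \<sigma> v"
  by (induction u) auto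

lemma reduced_adjacent:
  assumes "reduced \<sigma> (rev (us @ t # s # vs))"
  shows "\<not> contracts \<sigma> t s"
proof -
  have "reduced \<sigma> (s # t # rev us)"
    by (rule reduced_appendD[of _ "rev vs"]) (use assms in simp)
  then show ?thesis by (simp add: top_open_def)
qed

lemma reduced_no_fixed_point: "reduced \<sigma> u \<Longrightarrow> l \<in> labels u \<Longrightarrow> \<sigma> l \<noteq> l"
  by (induction u) auto

lemma card_labels: "labelled xs \<Longrightarrow> card (labels xs) = length xs"
  unfolding labelled_def labels_def by (metis distinct_card length_map list.set_map)

section \<open>Words that admit no further reduction\<close>

lemma cycle_count_reduced_le:
  assumes "p > 0" and "labelled xs" and \<sigma>: "\<sigma> permutes labels xs" and "reduced \<sigma> (rev xs)"
  shows "cycle_count p (labels xs) \<sigma> \<le> p ^ (length xs div 2)"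
  unfolding cycle_count_def card_labels[OF assms(2), symmetric]
proof (rule card_paired_functions_le)
  fix v assume v: "v \<in> labels xs"
  have "\<sigma> v \<in> labels xs" using permutes_in_image[OF \<sigma>, of v] v by simp
  moreover have "\<sigma> v \<noteq> v" using reduced_no_fixed_point[OF assms(4)] v by simp
  ultimately show "\<exists>w\<in>labels xs. w \<noteq> v \<and>
      (\<forall>f\<in>{f \<in> PiE (labels xs) (\<lambda>_. {..<p}). \<forall>l\<in>labels xs. f (\<sigma> l) = f l}. f w = f v)"
    using v by auto
qed (use assms in auto)

text \<open>The g-index of a Wishart block is its left index, that of a transposed block its right
  one; the junction there ties it to the neighbour. For a neighbour of the other kind this is the
  neighbour's own g-index. For one of the same kind it is the g-index of a preimage, and the absence
  of contractions makes that a different label. At the ends, cyclic closure supplies the label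
  0.\<close>

lemma closed_count_reduced_le:
  assumes d: "d > 0" and xs: "labelled xs" "xs \<noteq> []" and \<sigma>: "\<sigma> permutes labels xs"
    and red: "reduced \<sigma> (rev xs)"
  shows "closed_count d (map large_dir xs) \<sigma> \<le> d ^ (Suc (length xs) div 2)"
proof -
  let ?V = "insert 0 (labels xs)"
  let ?F = "{f \<in> PiE ?V (\<lambda>_. {..<d}). index_chain f (f \<circ> pinv \<sigma>) (f 0) (map large_dir xs) (f 0)}"
  have 0: "0 \<notin> labels xs" using xs by (simp add: labelled_def)
  have inv: "pinv \<sigma> l \<in> labels xs" if "l \<in> labels xs" for l
    using permutes_in_image[OF permutes_inv[OF \<sigma>], of l] that by simp
  have \<sigma>inv: "\<sigma> (pinv \<sigma> l) = l" for l using permutes_inverses(1)[OF \<sigma>] .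
  have chain: "index_chain f (f \<circ> pinv \<sigma>) (f 0) (map large_dir xs) (f 0)" if "f \<in> ?F" for f
    using that by simp
  have "\<exists>w\<in>?V. w \<noteq> v \<and> (\<forall>f\<in>?F. f w = f v)" if v: "v \<in> ?V" for v
  proof (cases "v = 0")
    case True
    obtain l c m ys where ys: "xs = (l, c, m) # ys" using xs(2) by (cases xs) auto
    have l: "l \<in> labels xs" by (simp add: ys)
    \<comment> \<open>The cut index 0 is itself tied, to the left index of the first block.\<close>
    define w where "w = (if c then l else pinv \<sigma> l)"
    have w: "w \<in> labels xs" using l inv[OF l] by (simp add: w_def)
    have "f w = f v" if "f \<in> ?F" for f
      using index_chain_first[of f "f \<circ> pinv \<sigma>" "f 0" l "if c then Fwd else Bwd" "map large_dir ys" "f 0"]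
        chain[OF that] True by (auto simp: ys w_def)
    moreover have "w \<noteq> v" using w 0 True by metis
    ultimately show ?thesis using w by (intro bexI[of _ w]) auto
  next
    case False
    then have "v \<in> fst ` set xs" using v by (simp add: labels_def)
    then obtain c m where "(v, c, m) \<in> set xs" by force
    then obtain us vs where split: "xs = us @ (v, c, m) # vs" by (auto dest: split_list)
    show ?thesis
    proof (cases c)
      case True
      show ?thesis
      proof (cases us rule: rev_cases)
        case Nil
        have "f 0 = f v" if "f \<in> ?F" for f
          using index_chain_first[of f "f \<circ> pinv \<sigma>" "f 0" v Fwd "map large_dir vs" "f 0"]
            chain[OF that] by (auto simp: split True Nil)
        then show ?thesis using False by (intro bexI[of _ 0]) auto
      next
        case (snoc us' t)
        obtain l c' m' where t: "t = (l, c', m')" by (cases t)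
        have l: "l \<in> labels xs" "l \<noteq> v" using xs by (auto simp: split snoc t labelled_def)
        have nc: "\<not> contracts \<sigma> t (v, c, m)"
          by (rule reduced_adjacent[of _ us' _ _ vs]) (use red in \<open>simp add: split snoc\<close>)
        define w where "w = (if c' then pinv \<sigma> l else l)"
        have w: "w \<in> labels xs" using l inv[OF l(1)] by (simp add: w_def)
        have "f w = f v" if "f \<in> ?F" for f
          using index_chain_adjacent[of f "f \<circ> pinv \<sigma>" "f 0" "map large_dir us'" l
              "if c' then Fwd else Bwd" v Fwd "map large_dir vs" "f 0"]
            chain[OF that] by (auto simp: split snoc t True w_def)
        moreover have "w \<noteq> v" using l nc \<sigma>inv[of l] True by (auto simp: w_def t)
        ultimately show ?thesis using w by (intro bexI[of _ w]) auto
      qed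
    next
      case cF: False
      show ?thesis
      proof (cases vs)
        case Nil
        have "f 0 = f v" if "f \<in> ?F" for f
          using index_chain_last[of f "f \<circ> pinv \<sigma>" "f 0" "map large_dir us" v Bwd "f 0"]
            chain[OF that] by (auto simp: split cF Nil)
        then show ?thesis using False by (intro bexI[of _ 0]) auto
      next
        case (Cons s vs')
        obtain l c' m' where s: "s = (l, c', m')" by (cases s)
        have l: "l \<in> labels xs" "l \<noteq> v" using xs by (auto simp: split Cons s labelled_def)
        have nc: "\<not> contracts \<sigma> (v, c, m) s"
          by (rule reduced_adjacent[of _ us _ _ vs']) (use red in \<open>simp add: split Cons\<close>)
        define w where "w = (if c' then l else pinv \<sigma> l)"
        have w: "w \<in> labels xs" using l inv[OF l(1)] by (simp add: w_def)
        have "f w = f v" if "f \<in> ?F" for f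
          using index_chain_adjacent[of f "f \<circ> pinv \<sigma>" "f 0" "map large_dir us" v Bwd l
              "if c' then Fwd else Bwd" "map large_dir vs'" "f 0"]
            chain[OF that] by (auto simp: split Cons s cF w_def)
        moreover have "w \<noteq> v" using l nc \<sigma>inv[of l] cF by (auto simp: w_def s)
        ultimately show ?thesis using w by (intro bexI[of _ w]) auto
      qed
    qed
  qed
  then have "card ?F \<le> d ^ (card ?V div 2)"
    by (intro card_paired_functions_le d) auto
  moreover have "card ?V = Suc (length xs)"
    using 0 by (simp add: card_labels[OF xs(1)])
  ultimately show ?thesis unfolding closed_count_def fst_set_map_dir by simp
qed

lemma closed_count_le: "closed_count d (map small_dir xs) \<sigma> \<le> d ^ card (insert 0 (labels xs))"
proof -
  have "closed_count d (map small_dir xs) \<sigma> \<le> card (PiE (insert 0 (labels xs)) (\<lambda>_. {..<d}))"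
    unfolding closed_count_def fst_set_map_dir by (rule card_mono) (auto intro: finite_PiE)
  then show ?thesis by (simp add: card_PiE)
qed

text \<open>For n blocks, n div 2 + (n + 1) div 2 = n falls one short of the exponent n + 1 of
  \<open>d2\<close> in the denominator; this leaves the factor 1 / \<open>d2\<close>. The trivial
  bound on the block indices is cancelled by their normalisation.\<close>

lemma norm_block_weight_reduced_le:
  assumes pos: "d1 > 0" "d2 > 0" "p > 0" and xs: "labelled xs" "xs \<noteq> []"
    and \<sigma>: "\<sigma> permutes labels xs" "reduced \<sigma> (rev xs)"
  shows "norm (block_weight d1 d2 p xs \<sigma>) \<le> (real p / real d2) ^ (length xs div 2) * inverse (real d2)"
proof -
  let ?n = "length xs"
  have card: "card (insert 0 (labels xs)) = Suc ?n"
    using xs(1) card_labels[OF xs(1)] by (simp add: labelled_def)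
  have "cycle_count p (labels xs) \<sigma> * closed_count d2 (map large_dir xs) \<sigma> *
      closed_count d1 (map small_dir xs) \<sigma> \<le>
      p ^ (?n div 2) * d2 ^ (Suc ?n div 2) * d1 ^ Suc ?n"
    using closed_count_le[of d1 xs \<sigma>] unfolding card
    by (intro mult_le_mono cycle_count_reduced_le closed_count_reduced_le pos xs \<sigma>)
  then have "norm (block_weight d1 d2 p xs \<sigma>) \<le>
      real (p ^ (?n div 2) * d2 ^ (Suc ?n div 2) * d1 ^ Suc ?n) / real (d1 * d2) ^ Suc ?n"
    unfolding block_weight_def norm_divide norm_power norm_of_nat
    by (intro divide_right_mono) (use of_nat_mono in blast, simp)
  also have "\<dots> = real p ^ (?n div 2) * (real d2 ^ (Suc ?n div 2) / real d2 ^ Suc ?n)"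
    using pos by (simp add: power_mult_distrib field_simps)
  also have "real d2 ^ Suc ?n = real d2 ^ (?n div 2) * real d2 ^ (Suc ?n div 2) * real d2"
  proof -
    have "Suc ?n = ?n div 2 + Suc ?n div 2 + 1" by presburger
    then show ?thesis by (metis power_add power_one_right)
  qed
  finally show ?thesis using pos by (simp add: field_simps power_divide)
qed

lemma stack_sum_exhausted_tendsto:
  assumes d1: "d1 > 0" and c: "c > 0"
    and p: "(\<lambda>d2. real (p d2) / (real d1 * real d2)) \<longlonglongrightarrow> c"
    and u: "labelled (rev u)" "u \<noteq> []"
  shows "(\<lambda>d2. stack_sum d1 d2 (p d2) u []) \<longlonglongrightarrow> 0"
proof -
  let ?n = "length u div 2"
  have "(\<lambda>d2. real d1 * (real (p d2) / (real d1 * real d2))) \<longlonglongrightarrow> real d1 * c"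
    by (intro tendsto_intros p)
  then have "(\<lambda>d2. real (p d2) / real d2) \<longlonglongrightarrow> real d1 * c"
    using d1 by (simp add: field_simps)
  then have "(\<lambda>d2. (real (p d2) / real d2) ^ ?n * inverse (real d2)) \<longlonglongrightarrow> (real d1 * c) ^ ?n * 0"
    by (intro tendsto_intros lim_inverse_n)
  then have bound: "(\<lambda>d2. (real (p d2) / real d2) ^ ?n * inverse (real d2)) \<longlonglongrightarrow> 0" by simp
  have "eventually (\<lambda>d2. real (p d2) / (real d1 * real d2) > 0) sequentially"
    using p c by (rule order_tendstoD)
  then have ev: "eventually (\<lambda>d2. d2 > 0 \<and> p d2 > 0) sequentially"
    by eventually_elim (auto intro!: gr0I)
  have "(\<lambda>d2. block_weight d1 d2 (p d2) (rev u) \<sigma>) \<longlonglongrightarrow> 0"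
    if \<sigma>: "\<sigma> permutes labels (rev u)" "reduced \<sigma> u" for \<sigma>
  proof (rule Lim_null_comparison[OF _ bound])
    show "\<forall>\<^sub>F d2 in sequentially. norm (block_weight d1 d2 (p d2) (rev u) \<sigma>) \<le>
        (real (p d2) / real d2) ^ ?n * inverse (real d2)"
      using ev
    proof eventually_elim
      case (elim d2)
      then show ?case
        using norm_block_weight_reduced_le[OF d1 _ _ u(1) _ \<sigma>(1), of d2 "p d2"] u \<sigma> by simp
    qed
  qed
  then show ?thesis
    unfolding stack_sum_def append_Nil2 by (intro tendsto_null_sum) auto
qed

text \<open>Without letters only the cut index remains, with \<open>d1 * d2\<close> values in total,
  which the normalised trace cancels.\<close>

lemma stack_sum_empty:
  assumes "d1 > 0" "d2 > 0"
  shows "stack_sum d1 d2 p [] [] = 1"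
proof -
  have perm: "{\<sigma> :: nat \<Rightarrow> nat. \<sigma> = id} = {id}" by auto
  have K: "cycle_count p {} id = 1" by (simp add: cycle_count_def)
  have C: "closed_count d [] id = d" for d by (simp add: closed_count_def card_PiE)
  show ?thesis
    using assms perm by (simp add: stack_sum_def block_weight_def K C)
qed

text \<open>The recursion at finite size has the shape of \<open>letter_op\<close>, with p / (d1 d2)
  in place of c. Labels disappear in the limit: only kinds and sizes of the open blocks matter. An
  exhausted word contributes only with an empty stack, which gives \<open>vacuum\<close>.\<close>

lemma stack_sum_tendsto:
  fixes c :: real
  assumes d1: "d1 > 0" and c: "c > 0"
    and p: "(\<lambda>d2. real (p d2) / (real d1 * real d2)) \<longlonglongrightarrow> c"
    and "labelled (rev u @ v)" and "\<forall>b\<in>set v. snd (snd b) = 1"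
  shows "(\<lambda>d2. stack_sum d1 d2 (p d2) u v) \<longlonglongrightarrow>
    stack_machine.word_op (close_weight d1 (of_real c)) (merge_weight d1) (map (fst \<circ> snd) v)
      stack_machine.vacuum (map snd u)"
  using assms(4,5)
proof (induction v arbitrary: u)
  case Nil
  show ?case
  proof (cases "u = []")
    case True
    have "eventually (\<lambda>d2. stack_sum d1 d2 (p d2) [] [] = 1) sequentially"
      using eventually_gt_at_top[of 0] by eventually_elim (use d1 in \<open>simp add: stack_sum_empty\<close>)
    then show ?thesis
      by (simp add: True stack_machine.word_op_def stack_machine.vacuum_def tendsto_eventually)
  next
    case False
    then show ?thesis
      using stack_sum_exhausted_tendsto[OF d1 c p] Nil
      by (simp add: stack_machine.word_op_def stack_machine.vacuum_def)
  qed
next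
  case (Cons b v)
  interpret stack_machine "close_weight d1 (of_real c)" "merge_weight d1" .
  define f where "f = word_op (map (fst \<circ> snd) v) vacuum"
  obtain a c0 where b: "b = (a, c0, 1)" using Cons.prems(2) by (cases b) auto
  have ev: "eventually (\<lambda>d2 :: nat. d2 > 0) sequentially" by (rule eventually_gt_at_top)
  have r: "(\<lambda>d2. of_nat (p d2) / of_nat (d1 * d2) :: complex) \<longlonglongrightarrow> of_real c"
  proof -
    have "(\<lambda>d2. complex_of_real (real (p d2) / (real d1 * real d2))) \<longlonglongrightarrow> complex_of_real c"
      by (intro tendsto_of_real p)
    then show ?thesis by simp
  qed
  have w: "(\<lambda>d2. close_weight d1 (of_nat (p d2) / of_nat (d1 * d2)) s) \<longlonglongrightarrow> close_weight d1 (of_real c) s" for s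
    unfolding close_weight_def case_prod_beta by (intro tendsto_mult r tendsto_const)
  have pending: "(\<lambda>d2. pending_sum d1 d2 (p d2) u s v) \<longlonglongrightarrow>
      close_weight d1 (of_real c) (snd s) * f (map snd u) + f (snd s # map snd u)"
    if l: "labelled (rev u @ s # v)" for u s
  proof -
    have "labelled (rev u @ v)" "labelled (rev (s # u) @ v)"
      using l by (auto simp: labelled_simps)
    then have IH: "(\<lambda>d2. stack_sum d1 d2 (p d2) u v) \<longlonglongrightarrow> f (map snd u)"
        "(\<lambda>d2. stack_sum d1 d2 (p d2) (s # u) v) \<longlonglongrightarrow> f (snd s # map snd u)"
      using Cons.IH[of u] Cons.IH[of "s # u"] Cons.prems(2) by (simp_all add: f_def comp_def)
    show ?thesis
    proof (rule Lim_transform_eventually)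
      show "(\<lambda>d2. close_weight d1 (of_nat (p d2) / of_nat (d1 * d2)) (snd s) * stack_sum d1 d2 (p d2) u v +
          stack_sum d1 d2 (p d2) (s # u) v) \<longlonglongrightarrow>
        close_weight d1 (of_real c) (snd s) * f (map snd u) + f (snd s # map snd u)"
        by (intro tendsto_intros w IH)
      show "\<forall>\<^sub>F d2 in sequentially.
          close_weight d1 (of_nat (p d2) / of_nat (d1 * d2)) (snd s) * stack_sum d1 d2 (p d2) u v +
          stack_sum d1 d2 (p d2) (s # u) v = pending_sum d1 d2 (p d2) u s v"
        using ev by eventually_elim (use pending_sum_rec[OF d1 _ l] in simp)
    qed
  qed
  let ?rest = "\<lambda>d2. case u of [] \<Rightarrow> 0 | t # u' \<Rightarrow> if fst (snd t) = c0
       then merge_weight d1 c0 * pending_sum d1 d2 (p d2) u' (merged t (a, c0, 1)) v else 0"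
  let ?lim = "case u of [] \<Rightarrow> 0 | t # u' \<Rightarrow> if fst (snd t) = c0
       then merge_weight d1 c0 * (close_weight d1 (of_real c) (c0, Suc (snd (snd t))) * f (map snd u')
         + f ((c0, Suc (snd (snd t))) # map snd u')) else 0"
  have rest: "?rest \<longlonglongrightarrow> ?lim"
  proof (cases u)
    case (Cons t u')
    obtain lt ct m where t: "t = (lt, ct, m)" by (cases t)
    show ?thesis
    proof (cases "ct = c0")
      case True
      have "labelled (rev u' @ t # b # v)" using \<open>labelled (rev u @ b # v)\<close> Cons by simp
      then have "labelled (rev u' @ merged t (a, c0, 1) # v)"
        by (auto simp: t b labelled_def labels_def)
      from pending[OF this] show ?thesis
        by (auto simp: Cons t True intro!: tendsto_intros)
    qed (simp add: Cons t)
  qed simp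
  have "(\<lambda>d2. pending_sum d1 d2 (p d2) u b v + ?rest d2) \<longlonglongrightarrow>
      close_weight d1 (of_real c) (c0, 1) * f (map snd u) + f ((c0, 1) # map snd u) + ?lim"
    using tendsto_add[OF pending[OF Cons.prems(1)] rest] by (simp add: b)
  also have "close_weight d1 (of_real c) (c0, 1) * f (map snd u) + f ((c0, 1) # map snd u) + ?lim =
      letter_op c0 f (map snd u)"
    by (cases u) (auto split: prod.splits)
  finally have lim: "(\<lambda>d2. pending_sum d1 d2 (p d2) u b v + ?rest d2) \<longlonglongrightarrow> letter_op c0 f (map snd u)" .
  have "word_op (map (fst \<circ> snd) (b # v)) vacuum = letter_op c0 f"
    by (simp add: f_def word_op_def b)
  moreover have "(\<lambda>d2. stack_sum d1 d2 (p d2) u (b # v)) \<longlonglongrightarrow> letter_op c0 f (map snd u)"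
  proof (rule Lim_transform_eventually[OF lim])
    show "\<forall>\<^sub>F d2 in sequentially. pending_sum d1 d2 (p d2) u b v + ?rest d2 = stack_sum d1 d2 (p d2) u (b # v)"
      using ev
    proof eventually_elim
      case (elim d2)
      show ?case
        using stack_sum_rec[OF d1 elim Cons.prems(1)[unfolded b], of "p d2"] unfolding b by (rule sym)
    qed
  qed
  ultimately show ?case by (simp only:)
qed

section \<open>Expansion of the trace\<close>

lemma sum_PiE_insert:
  fixes H :: "('l \<Rightarrow> 'b) \<Rightarrow> 'c :: comm_monoid_add"
  assumes "l \<notin> S"
  shows "(\<Sum>F\<in>PiE (insert l S) (\<lambda>_. D). H F) = (\<Sum>F\<in>PiE S (\<lambda>_. D). \<Sum>v\<in>D. H (F(l := v)))"
proof -
  have inj: "inj_on (\<lambda>(v, F). F(l := v)) (D \<times> PiE S (\<lambda>_. D))"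
    using assms inj_combinator[of l S "\<lambda>_. D"] by simp
  have "(\<Sum>F\<in>PiE (insert l S) (\<lambda>_. D). H F) = (\<Sum>(v, F)\<in>D \<times> PiE S (\<lambda>_. D). H (F(l := v)))"
    unfolding PiE_insert_eq sum.reindex[OF inj] by (simp add: comp_def case_prod_unfold)
  also have "\<dots> = (\<Sum>v\<in>D. \<Sum>F\<in>PiE S (\<lambda>_. D). H (F(l := v)))"
    by (rule sum.cartesian_product[symmetric])
  also have "\<dots> = (\<Sum>F\<in>PiE S (\<lambda>_. D). \<Sum>v\<in>D. H (F(l := v)))"
    by (rule sum.swap)
  finally show ?thesis .
qed

lemma sum_divide_product:
  fixes a :: "'b \<Rightarrow> 'f :: field" and b :: "'c \<Rightarrow> 'f"
  shows "sum a A / n * (sum b B / n ^ k) = (\<Sum>y\<in>B. \<Sum>x\<in>A. a x * b y) / n ^ Suc k"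
  unfolding sum.swap[of _ A B] by (simp add: sum_product)

lemma sum_of_bool_point:
  fixes h :: "nat \<Rightarrow> 'f :: semiring_1"
  assumes "m < n"
  shows "(\<Sum>q<n. of_bool (q = m) * h q) = h m"
proof -
  have "(\<Sum>q<n. of_bool (q = m) * h q) = (\<Sum>q<n. if q = m then h q else 0)"
    by (rule sum.cong) auto
  then show ?thesis using assms by simp
qed

type_synonym entry_index = "(nat \<times> nat) \<times> (nat \<times> nat) \<times> nat"

text \<open>The index of a letter lists the block rows and the inner rows of the factors
  \<open>g\<close> and \<open>cnj g\<close>, and their common column.\<close>

definition entry_indices :: "nat \<Rightarrow> nat \<Rightarrow> nat \<Rightarrow> entry_index set" where
  "entry_indices d1 d2 p = ({..<d1} \<times> {..<d1}) \<times> ({..<d2} \<times> {..<d2}) \<times> {..<p}"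

definition g_index :: "entry_index \<Rightarrow> nat \<times> nat \<times> nat" where
  "g_index v = (fst (fst v), fst (fst (snd v)), snd (snd v))"

definition cnj_index :: "entry_index \<Rightarrow> nat \<times> nat \<times> nat" where
  "cnj_index v = (snd (fst v), snd (fst (snd v)), snd (snd v))"

definition wishart_letter ::
    "nat \<Rightarrow> nat \<Rightarrow> nat \<Rightarrow> (nat \<Rightarrow> nat \<Rightarrow> nat \<Rightarrow> 'w \<Rightarrow> complex) \<Rightarrow> 'w \<Rightarrow> bool \<Rightarrow> complex mat" where
  "wishart_letter d1 d2 p g \<omega> b = (if b then wishart d1 d2 p g \<omega> else wishart_right_transpose d1 d2 p g \<omega>)"

context
  fixes d1 d2 p :: nat and g :: "nat \<Rightarrow> nat \<Rightarrow> nat \<Rightarrow> 'w \<Rightarrow> complex"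
  assumes d: "d1 > 0" "d2 > 0"
begin

abbreviation (input) "N \<equiv> d1 * d2"
abbreviation (input) "D \<equiv> entry_indices d1 d2 p"

definition factor_pair :: "'w \<Rightarrow> entry_index \<Rightarrow> complex" where
  "factor_pair \<omega> v = (case g_index v of (i, j, k) \<Rightarrow> g i j k \<omega>) * cnj (case cnj_index v of (i, j, k) \<Rightarrow> g i j k \<omega>)"

lemma finite_D: "finite D"
  by (simp add: entry_indices_def)

lemma wishart_letter_carrier: "wishart_letter d1 d2 p g \<omega> b \<in> carrier_mat N N"
  by (simp add: wishart_letter_def wishart_def wishart_right_transpose_def block_matrix_def)

lemma word_mat_carrier: "word_mat N (wishart_letter d1 d2 p g \<omega>) w \<in> carrier_mat N N"
  by (induction w) (auto simp: word_mat_def intro: mult_carrier_mat wishart_letter_carrier)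

lemma wishart_block_entry:
  assumes "a < d2" "b < d2"
  shows "wishart_block d2 p g i j \<omega> $$ (a, b) = (\<Sum>k<p. g i a k \<omega> * cnj (g j b k \<omega>)) / of_nat d2"
  using assms by (simp add: wishart_block_def gaussian_matrix_def mat_adjoint_def scalar_prod_def
      lessThan_atLeast0 mat_of_rows_def)

lemma wishart_letter_entry:
  assumes "r < N" "s < N"
  shows "wishart_letter d1 d2 p g \<omega> c $$ (r, s) =
    (\<Sum>k<p. if c then g (r div d2) (r mod d2) k \<omega> * cnj (g (s div d2) (s mod d2) k \<omega>)
      else g (r div d2) (s mod d2) k \<omega> * cnj (g (s div d2) (r mod d2) k \<omega>)) / of_nat N"
proof -
  have "r mod d2 < d2" "s mod d2 < d2" using d by simp_all
  then show ?thesis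
    using assms by (simp add: wishart_letter_def wishart_def wishart_right_transpose_def
        block_matrix_def wishart_block_entry index_transpose_mat wishart_block_def[THEN arg_cong[where f = dim_row]]
        wishart_block_def[THEN arg_cong[where f = dim_col]] gaussian_matrix_def mat_adjoint_def)
qed

text \<open>Moving the row conditions into an indicator lets all letters range over the same index
  set, so that a word becomes one sum over functions on its labels.\<close>

lemma wishart_letter_entry_sum:
  assumes rs: "r < N" "s < N"
  shows "wishart_letter d1 d2 p g \<omega> c $$ (r, s) =
    (\<Sum>v\<in>D. of_bool (fst (fst v) = r div d2 \<and> snd (fst v) = s div d2 \<and>
      (if c then fst (fst (snd v)) = r mod d2 \<and> snd (fst (snd v)) = s mod d2
       else snd (fst (snd v)) = r mod d2 \<and> fst (fst (snd v)) = s mod d2)) * factor_pair \<omega> v) / of_nat N"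
    (is "_ = (\<Sum>v\<in>D. of_bool (?P v) * _) / _")
proof -
  let ?v = "\<lambda>k. ((r div d2, s div d2), if c then (r mod d2, s mod d2) else (s mod d2, r mod d2), k)"
  have "r div d2 < d1" "s div d2 < d1" "r mod d2 < d2" "s mod d2 < d2"
    using rs d by (simp_all add: less_mult_imp_div_less)
  then have mem: "?v k \<in> D" if "k < p" for k using that by (auto simp: entry_indices_def)
  have eq: "{v \<in> D. ?P v} = ?v ` {..<p}"
  proof
    show "{v \<in> D. ?P v} \<subseteq> ?v ` {..<p}"
      by (auto simp: entry_indices_def image_iff split: if_splits)
    show "?v ` {..<p} \<subseteq> {v \<in> D. ?P v}" using mem by auto
  qed
  have inj: "inj_on ?v {..<p}" by (auto intro: inj_onI)
  have "(\<Sum>v\<in>D. of_bool (?P v) * factor_pair \<omega> v) = (\<Sum>v | v \<in> D \<and> ?P v. factor_pair \<omega> v)"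
    using finite_D by (intro sum.mono_neutral_cong_right) auto
  also have "\<dots> = (\<Sum>k<p. factor_pair \<omega> (?v k))"
    unfolding eq by (subst sum.reindex[OF inj]) simp
  finally show ?thesis
    unfolding wishart_letter_entry[OF rs]
    by (simp add: factor_pair_def g_index_def cnj_index_def)
qed

definition word_constraint :: "(nat \<Rightarrow> entry_index) \<Rightarrow> nat \<Rightarrow> block list \<Rightarrow> nat \<Rightarrow> bool" where
  "word_constraint F r xs s \<longleftrightarrow>
     index_chain (\<lambda>l. fst (fst (F l))) (\<lambda>l. snd (fst (F l))) (r div d2) (map small_dir xs) (s div d2) \<and>
     index_chain (\<lambda>l. fst (fst (snd (F l)))) (\<lambda>l. snd (fst (snd (F l)))) (r mod d2) (map large_dir xs) (s mod d2)"

lemma word_constraint_cong: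
  assumes "\<And>l. l \<in> labels xs \<Longrightarrow> F l = F' l"
  shows "word_constraint F r xs s = word_constraint F' r xs s"
  unfolding word_constraint_def using assms
  by (intro arg_cong2[where f = "(\<and>)"] index_chain_cong) (simp_all only: fst_set_map_dir)

text \<open>The right indices of a letter determine the row at which the rest of the word starts.
  The sum over the intermediate matrix index thus collapses, and the chain grows by one
  letter.\<close>

lemma word_mat_entry:
  assumes "labelled xs" and "\<forall>b\<in>set xs. snd (snd b) = 1" and "r < N" "s < N"
  shows "word_mat N (wishart_letter d1 d2 p g \<omega>) (map (fst \<circ> snd) xs) $$ (r, s) =
    (\<Sum>F\<in>PiE (labels xs) (\<lambda>_. D). of_bool (word_constraint F r xs s) * (\<Prod>l\<in>labels xs. factor_pair \<omega> (F l)))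
      / of_nat N ^ length xs"
  using assms
proof (induction xs arbitrary: r)
  case Nil
  have "r = s \<longleftrightarrow> r div d2 = s div d2 \<and> r mod d2 = s mod d2"
    by (metis div_mult_mod_eq)
  then show ?case using Nil by (simp add: word_mat_def word_constraint_def)
next
  case (Cons x xs)
  obtain l c where x: "x = (l, c, 1)" using Cons.prems(2) by (cases x) auto
  have l: "l \<notin> labels xs" using Cons.prems(1) labelled_simps[of "[]" x xs] by (simp add: x)
  have xs: "labelled xs" "\<forall>b\<in>set xs. snd (snd b) = 1"
    using Cons.prems labelled_simps[of "[]" x xs] by simp_all
  let ?A = "wishart_letter d1 d2 p g \<omega>"
  let ?W = "word_mat N ?A (map (fst \<circ> snd) xs)"
  let ?n = "of_nat N :: complex"
  let ?P = "\<lambda>F. \<Prod>l\<in>labels xs. factor_pair \<omega> (F l)"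
  have W: "?W \<in> carrier_mat N N"
    by (rule word_mat_carrier)
  let ?L = "\<lambda>v. fst (fst v) = r div d2 \<and> (if c then fst (fst (snd v)) = r mod d2 else snd (fst (snd v)) = r mod d2)"
  \<comment> \<open>The matrix index with the right block index of the letter as quotient and its
    right inner index as remainder; the kind selects the latter.\<close>
  let ?q = "\<lambda>v. snd (fst v) * d2 + (if c then snd (fst (snd v)) else fst (fst (snd v)))"
  have qN: "?q v < N" and q: "?q v div d2 = snd (fst v)"
      "?q v mod d2 = (if c then snd (fst (snd v)) else fst (fst (snd v)))" if "v \<in> D" for v
  proof -
    have *: "snd (fst v) < d1" "(if c then snd (fst (snd v)) else fst (fst (snd v))) < d2"
      using that by (auto simp: entry_indices_def)
    then show "?q v div d2 = snd (fst v)"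
      "?q v mod d2 = (if c then snd (fst (snd v)) else fst (fst (snd v)))" by simp_all
    have "?q v < Suc (snd (fst v)) * d2" using * by simp
    also have "\<dots> \<le> N" using * by (intro mult_right_mono) auto
    finally show "?q v < N" .
  qed
  have letter: "?A c $$ (r, q) = (\<Sum>v\<in>D. of_bool (?L v) * of_bool (q = ?q v) * factor_pair \<omega> v) / ?n"
    if "q < N" for q
  proof -
    have "q = ?q v \<longleftrightarrow> snd (fst v) = q div d2 \<and> (if c then snd (fst (snd v)) else fst (fst (snd v))) = q mod d2"
      if "v \<in> D" for v
      using q[OF that] by (metis div_mult_mod_eq)
    then show ?thesis
      unfolding wishart_letter_entry_sum[OF Cons.prems(3) that]
      by (intro arg_cong2[where f = "(/)"] sum.cong refl) (auto simp: of_bool_def)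
  qed
  have "word_mat N ?A (map (fst \<circ> snd) (x # xs)) $$ (r, s) = (\<Sum>q<N. ?A c $$ (r, q) * ?W $$ (q, s))"
  proof -
    have "word_mat N ?A (map (fst \<circ> snd) (x # xs)) = ?A c * ?W" by (simp add: word_mat_def x)
    then show ?thesis
      using W wishart_letter_carrier[of \<omega> c] Cons.prems
      by (simp add: scalar_prod_def lessThan_atLeast0)
  qed
  also have "\<dots> = (\<Sum>q<N. (\<Sum>v\<in>D. of_bool (?L v) * of_bool (q = ?q v) * factor_pair \<omega> v) / ?n *
      ((\<Sum>F\<in>PiE (labels xs) (\<lambda>_. D). of_bool (word_constraint F q xs s) * ?P F) / ?n ^ length xs))"
    using Cons.prems(4) by (intro sum.cong refl arg_cong2[where f = "(*)"] letter Cons.IH xs) auto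
  also have "\<dots> = (\<Sum>q<N. \<Sum>F\<in>PiE (labels xs) (\<lambda>_. D). \<Sum>v\<in>D.
      of_bool (q = ?q v) * (of_bool (?L v) * of_bool (word_constraint F q xs s) * (factor_pair \<omega> v * ?P F)))
      / ?n ^ Suc (length xs)"
    unfolding sum_divide_product sum_divide_distrib[symmetric]
    by (intro arg_cong2[where f = "(/)"] sum.cong refl) (simp only: ac_simps)
  also have "(\<Sum>q<N. \<Sum>F\<in>PiE (labels xs) (\<lambda>_. D). \<Sum>v\<in>D.
      of_bool (q = ?q v) * (of_bool (?L v) * of_bool (word_constraint F q xs s) * (factor_pair \<omega> v * ?P F))) =
    (\<Sum>F\<in>PiE (labels xs) (\<lambda>_. D). \<Sum>v\<in>D. \<Sum>q<N.
      of_bool (q = ?q v) * (of_bool (?L v) * of_bool (word_constraint F q xs s) * (factor_pair \<omega> v * ?P F)))"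
    by (subst sum.swap, rule sum.cong[OF refl], rule sum.swap)
  also have "\<dots> = (\<Sum>F\<in>PiE (labels xs) (\<lambda>_. D). \<Sum>v\<in>D.
      of_bool (?L v \<and> word_constraint F (?q v) xs s) * (factor_pair \<omega> v * ?P F))"
  proof (intro sum.cong refl)
    fix F v assume "v \<in> D"
    then show "(\<Sum>q<N. of_bool (q = ?q v) * (of_bool (?L v) * of_bool (word_constraint F q xs s) *
        (factor_pair \<omega> v * ?P F))) = of_bool (?L v \<and> word_constraint F (?q v) xs s) * (factor_pair \<omega> v * ?P F)"
      by (subst sum_of_bool_point[OF qN]) (simp_all only: of_bool_conj)
  qed
  also have "\<dots> = (\<Sum>F\<in>PiE (labels xs) (\<lambda>_. D). \<Sum>v\<in>D.
      of_bool (word_constraint (F(l := v)) r (x # xs) s) * (\<Prod>l'\<in>labels (x # xs). factor_pair \<omega> ((F(l := v)) l')))"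
  proof (intro sum.cong refl arg_cong2[where f = "(*)"])
    fix F v assume v: "v \<in> D"
    have "word_constraint (F(l := v)) (?q v) xs s = word_constraint F (?q v) xs s"
      by (rule word_constraint_cong) (use l in auto)
    then have "word_constraint (F(l := v)) r (x # xs) s \<longleftrightarrow> ?L v \<and> word_constraint F (?q v) xs s"
      using q[OF v] by (cases c) (auto simp: word_constraint_def x)
    then show "of_bool (?L v \<and> word_constraint F (?q v) xs s) =
        (of_bool (word_constraint (F(l := v)) r (x # xs) s) :: complex)" by simp
    have "(\<Prod>l'\<in>labels xs. factor_pair \<omega> ((F(l := v)) l')) = ?P F"
      by (rule prod.cong) (use l in auto)
    then show "factor_pair \<omega> v * ?P F = (\<Prod>l'\<in>labels (x # xs). factor_pair \<omega> ((F(l := v)) l'))"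
      using l by (simp add: x del: fun_upd_apply) simp
  qed
  also have "\<dots> = (\<Sum>F\<in>PiE (labels (x # xs)) (\<lambda>_. D).
      of_bool (word_constraint F r (x # xs) s) * (\<Prod>l'\<in>labels (x # xs). factor_pair \<omega> (F l')))"
  proof -
    have "labels (x # xs) = insert l (labels xs)" by (simp add: x)
    then show ?thesis by (simp only: sum_PiE_insert[OF l])
  qed
  finally show ?case by simp
qed

text \<open>The matching condition expresses conjugated indices as unconjugated ones at
  \<open>pinv \<sigma>\<close>, so columns, inner indices and block indices are chosen separately.
  Quotient and remainder of the row \<open>r\<close> become the values at label 0.\<close>

lemma card_index_matchings:
  assumes xs: "labelled xs" and \<sigma>: "\<sigma> permutes labels xs"
  shows "card {(r, F). r < N \<and> F \<in> PiE (labels xs) (\<lambda>_. D) \<and> word_constraint F r xs r \<and>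
      (\<forall>l\<in>labels xs. g_index (F l) = cnj_index (F (\<sigma> l)))} =
    cycle_count p (labels xs) \<sigma> * closed_count d2 (map large_dir xs) \<sigma> * closed_count d1 (map small_dir xs) \<sigma>"
proof -
  let ?S = "labels xs" and ?\<tau> = "pinv \<sigma>"
  let ?K = "{k \<in> PiE ?S (\<lambda>_. {..<p}). \<forall>l\<in>?S. k (\<sigma> l) = k l}"
  let ?A = "{f \<in> PiE (insert 0 ?S) (\<lambda>_. {..<d2}). index_chain f (f \<circ> ?\<tau>) (f 0) (map large_dir xs) (f 0)}"
  let ?I = "{f \<in> PiE (insert 0 ?S) (\<lambda>_. {..<d1}). index_chain f (f \<circ> ?\<tau>) (f 0) (map small_dir xs) (f 0)}"
  let ?T = "{(r, F). r < N \<and> F \<in> PiE ?S (\<lambda>_. D) \<and> word_constraint F r xs r \<and>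
      (\<forall>l\<in>?S. g_index (F l) = cnj_index (F (\<sigma> l)))}"
  let ?F = "\<lambda>k fa fi. \<lambda>l\<in>?S. ((fi l, fi (?\<tau> l)), (fa l, fa (?\<tau> l)), k l)"
  let ?\<Phi> = "\<lambda>(k, fa, fi). (fi 0 * d2 + fa 0, ?F k fa fi)"
  let ?k = "\<lambda>F. \<lambda>l\<in>?S. snd (snd (F l))"
  let ?a = "\<lambda>r F. \<lambda>l\<in>insert 0 ?S. if l = 0 then r mod d2 else fst (fst (snd (F l)))"
  let ?i = "\<lambda>r F. \<lambda>l\<in>insert 0 ?S. if l = 0 then r div d2 else fst (fst (F l))"
  let ?\<Psi> = "\<lambda>(r, F). (?k F, ?a r F, ?i r F)"
  have n0: "l \<noteq> 0" if "l \<in> ?S" for l using xs that unfolding labelled_def by metis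
  have \<tau>S: "?\<tau> l \<in> ?S" if "l \<in> ?S" for l
    using permutes_in_image[OF permutes_inv[OF \<sigma>], of l] that by simp
  have \<sigma>S: "\<sigma> l \<in> ?S" if "l \<in> ?S" for l
    using permutes_in_image[OF \<sigma>, of l] that by simp
  have \<sigma>\<tau>: "\<sigma> (?\<tau> l) = l" "?\<tau> (\<sigma> l) = l" for l using permutes_inverses[OF \<sigma>] by auto
  have chain: "word_constraint F r xs r \<longleftrightarrow>
      index_chain fi (fi \<circ> ?\<tau>) (fi 0) (map small_dir xs) (fi 0) \<and>
      index_chain fa (fa \<circ> ?\<tau>) (fa 0) (map large_dir xs) (fa 0)"
    if "r div d2 = fi 0" "r mod d2 = fa 0"
      "\<And>l. l \<in> ?S \<Longrightarrow> fst (F l) = (fi l, fi (?\<tau> l)) \<and> fst (snd (F l)) = (fa l, fa (?\<tau> l))" for F r fa fi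
    unfolding word_constraint_def that(1,2)
    by (intro arg_cong2[where f = "(\<and>)"] index_chain_cong) (simp_all only: fst_set_map_dir that(3) o_apply fst_conv snd_conv)
  have inner: "fst (F l) = (?i r F l, ?i r F (?\<tau> l))" "fst (snd (F l)) = (?a r F l, ?a r F (?\<tau> l))"
    if "(r, F) \<in> ?T" and l: "l \<in> ?S" for r F l
  proof -
    have "g_index (F (?\<tau> l)) = cnj_index (F l)" using that \<tau>S[OF l] \<sigma>\<tau>(1)[of l] by force
    then have "fst (fst (F (?\<tau> l))) = snd (fst (F l))" "fst (fst (snd (F (?\<tau> l)))) = snd (fst (snd (F l)))"
      by (simp_all add: g_index_def cnj_index_def)
    then show "fst (F l) = (?i r F l, ?i r F (?\<tau> l))" "fst (snd (F l)) = (?a r F l, ?a r F (?\<tau> l))"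
      using l \<tau>S[OF l] n0[OF l] n0[OF \<tau>S[OF l]] by (simp_all add: prod_eq_iff)
  qed
  have bij: "bij_betw ?\<Phi> (?K \<times> ?A \<times> ?I) ?T"
  proof (rule bij_betwI[where g = ?\<Psi>])
    show "?\<Phi> \<in> ?K \<times> ?A \<times> ?I \<rightarrow> ?T"
    proof (rule Pi_I)
      fix x assume "x \<in> ?K \<times> ?A \<times> ?I"
      then obtain k fa fi where x: "x = (k, fa, fi)" and k: "k \<in> ?K" and a: "fa \<in> ?A" and i: "fi \<in> ?I"
        by auto
      have D: "fa l < d2" "fi l < d1" if "l = 0 \<or> l \<in> ?S" for l
        using a i that by (auto simp: PiE_iff)
      have kp: "k l < p" "k (\<sigma> l) = k l" if "l \<in> ?S" for l
        using k that by (auto simp: PiE_iff)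
      let ?r = "fi 0 * d2 + fa 0"
      have "?r < Suc (fi 0) * d2" using D[of 0] by simp
      also have "\<dots> \<le> N" using D[of 0] by (intro mult_right_mono) auto
      finally have "?r < N" .
      moreover have "?F k fa fi \<in> PiE ?S (\<lambda>_. D)"
        using D kp \<tau>S by (auto simp: entry_indices_def)
      moreover have "word_constraint (?F k fa fi) ?r xs ?r"
        by (subst chain[of ?r fi fa]) (use D[of 0] a i in auto)
      moreover have "\<forall>l\<in>?S. g_index (?F k fa fi l) = cnj_index (?F k fa fi (\<sigma> l))"
        using \<sigma>S \<sigma>\<tau> kp by (simp add: g_index_def cnj_index_def)
      ultimately show "?\<Phi> x \<in> ?T" by (simp add: x)
    qed
    show "?\<Psi> \<in> ?T \<rightarrow> ?K \<times> ?A \<times> ?I"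
    proof (rule Pi_I)
      fix x assume xT: "x \<in> ?T"
      obtain r F where x: "x = (r, F)" by (cases x)
      have r: "r < N" and F: "F \<in> PiE ?S (\<lambda>_. D)" and wc: "word_constraint F r xs r"
        and match: "\<And>l. l \<in> ?S \<Longrightarrow> g_index (F l) = cnj_index (F (\<sigma> l))"
        using xT x by auto
      have FD: "F l \<in> D" if "l \<in> ?S" for l using F that by auto
      have rd: "r div d2 < d1" "r mod d2 < d2" using r d by (simp_all add: less_mult_imp_div_less)
      have FDc: "fst (fst (F l)) < d1 \<and> fst (fst (snd (F l))) < d2 \<and> snd (snd (F l)) < p"
        if "l \<in> ?S" for l using FD[OF that] by (auto simp: entry_indices_def)
      have "?k F \<in> PiE ?S (\<lambda>_. {..<p})" using FDc by (simp add: PiE_iff)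
      moreover have "?k F (\<sigma> l) = ?k F l" if "l \<in> ?S" for l
        using match[OF that] \<sigma>S[OF that] that by (simp add: g_index_def cnj_index_def)
      moreover have "?a r F \<in> PiE (insert 0 ?S) (\<lambda>_. {..<d2})"
        using FDc rd by (simp add: PiE_iff)
      moreover have "?i r F \<in> PiE (insert 0 ?S) (\<lambda>_. {..<d1})"
        using FDc rd by (simp add: PiE_iff)
      moreover have "index_chain (?i r F) (?i r F \<circ> ?\<tau>) (?i r F 0) (map small_dir xs) (?i r F 0) \<and>
          index_chain (?a r F) (?a r F \<circ> ?\<tau>) (?a r F 0) (map large_dir xs) (?a r F 0)"
        using wc by (subst (asm) chain[of r "?i r F" "?a r F"]) (use inner[of r F] xT x in auto)
      ultimately show "?\<Psi> x \<in> ?K \<times> ?A \<times> ?I" unfolding x by simp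
    qed
  next
    fix x assume "x \<in> ?K \<times> ?A \<times> ?I"
    then obtain k fa fi where x: "x = (k, fa, fi)" and k: "k \<in> ?K" and a: "fa \<in> ?A" and i: "fi \<in> ?I"
      by auto
    have a0: "fa 0 < d2" using a by (auto simp: PiE_iff)
    have "?k (?F k fa fi) = k"
      using k by (auto simp: PiE_iff extensional_def fun_eq_iff)
    moreover have "?a (fi 0 * d2 + fa 0) (?F k fa fi) = fa"
      using a a0 n0 by (auto simp: PiE_iff extensional_def fun_eq_iff)
    moreover have "?i (fi 0 * d2 + fa 0) (?F k fa fi) = fi"
      using i a0 n0 by (auto simp: PiE_iff extensional_def fun_eq_iff)
    ultimately show "?\<Psi> (?\<Phi> x) = x" by (simp add: x)
  next
    fix x assume xT: "x \<in> ?T"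
    obtain r F where x: "x = (r, F)" by (cases x)
    have F: "F \<in> PiE ?S (\<lambda>_. D)" using xT x by auto
    have "?F (?k F) (?a r F) (?i r F) l = F l" for l
    proof (cases "l \<in> ?S")
      case True
      then have "?F (?k F) (?a r F) (?i r F) l = (fst (F l), fst (snd (F l)), snd (snd (F l)))"
        using inner[of r F l] xT x by simp
      then show ?thesis by simp
    next
      case False
      then show ?thesis using F by (auto simp: PiE_iff extensional_def)
    qed
    then have "?F (?k F) (?a r F) (?i r F) = F" by (rule ext)
    moreover have "?i r F 0 * d2 + ?a r F 0 = r" by simp
    ultimately show "?\<Phi> (?\<Psi> x) = x" unfolding x by simp
  qed
  have "card ?T = card (?K \<times> ?A \<times> ?I)" by (rule bij_betw_same_card[OF bij, symmetric])
  also have "\<dots> = cycle_count p ?S \<sigma> * closed_count d2 (map large_dir xs) \<sigma> * closed_count d1 (map small_dir xs) \<sigma>"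
    unfolding cycle_count_def closed_count_def fst_set_map_dir card_cartesian_product by simp
  finally show ?thesis .
qed

lemma normalized_trace_word:
  assumes "labelled xs" and "\<forall>b\<in>set xs. snd (snd b) = 1"
  shows "normalized_trace (word_mat N (wishart_letter d1 d2 p g \<omega>) (map (fst \<circ> snd) xs)) =
    (\<Sum>(r, F)\<in>{..<N} \<times> PiE (labels xs) (\<lambda>_. D). of_bool (word_constraint F r xs r) *
      (\<Prod>l\<in>labels xs. factor_pair \<omega> (F l))) / of_nat N ^ Suc (length xs)"
proof -
  have "normalized_trace (word_mat N (wishart_letter d1 d2 p g \<omega>) (map (fst \<circ> snd) xs)) =
    (\<Sum>r<N. word_mat N (wishart_letter d1 d2 p g \<omega>) (map (fst \<circ> snd) xs) $$ (r, r)) / of_nat N"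
    using carrier_matD(1)[OF word_mat_carrier] by (simp only: normalized_trace_def)
  also have "\<dots> = (\<Sum>r<N. (\<Sum>F\<in>PiE (labels xs) (\<lambda>_. D). of_bool (word_constraint F r xs r) *
      (\<Prod>l\<in>labels xs. factor_pair \<omega> (F l))) / of_nat N ^ length xs) / of_nat N"
    using assms by (intro arg_cong2[where f = "(/)"] sum.cong refl word_mat_entry) auto
  finally show ?thesis
    by (simp only: sum_divide_distrib[symmetric] sum.cartesian_product divide_divide_eq_left power_Suc2)
qed

lemma
  assumes gauss: "gaussian_entries M d1 d2 p g"
    and xs: "labelled xs" "\<forall>b\<in>set xs. snd (snd b) = 1"
  shows integrable_normalized_trace_word:
      "integrable M (\<lambda>\<omega>. normalized_trace (word_mat N (wishart_letter d1 d2 p g \<omega>) (map (fst \<circ> snd) xs)))" (is ?int)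
    and integral_normalized_trace_word:
      "integral\<^sup>L M (\<lambda>\<omega>. normalized_trace (word_mat N (wishart_letter d1 d2 p g \<omega>) (map (fst \<circ> snd) xs))) =
        stack_sum d1 d2 p [] xs" (is ?eq)
proof -
  let ?S = "labels xs"
  let ?X = "{..<N} \<times> PiE ?S (\<lambda>_. D)"
  let ?I = "{..<d1} \<times> {..<d2} \<times> {..<p}"
  let ?Z = "\<lambda>(i, j, k). g i j k"
  let ?n = "of_nat N ^ Suc (length xs) :: complex"
  let ?c = "\<lambda>r F. of_bool (word_constraint F r xs r) :: complex"
  let ?match = "\<lambda>F \<sigma>. \<forall>l\<in>?S. g_index (F l) = cnj_index (F (\<sigma> l))"
  interpret prob_space M using gauss by (simp add: gaussian_entries_def)
  have ind: "indep_vars (\<lambda>_. borel) ?Z ?I" using gauss by (simp add: gaussian_entries_def)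
  have gaussian: "complex_gaussian 1 (?Z \<iota>)" if "\<iota> \<in> ?I" for \<iota>
    using gauss that by (auto simp: gaussian_entries_def)
  have fp: "factor_pair \<omega> v = ?Z (g_index v) \<omega> * cnj (?Z (cnj_index v) \<omega>)" for \<omega> v
    by (simp add: factor_pair_def case_prod_beta)
  have wick: "integrable M (\<lambda>\<omega>. \<Prod>l\<in>?S. factor_pair \<omega> (F l))"
      "expectation (\<lambda>\<omega>. \<Prod>l\<in>?S. factor_pair \<omega> (F l)) = of_nat (card {\<sigma>. \<sigma> permutes ?S \<and> ?match F \<sigma>})"
    if F: "F \<in> PiE ?S (\<lambda>_. D)" for F
  proof -
    have "F l \<in> D" if "l \<in> ?S" for l using F that by auto
    then have "(\<lambda>l. g_index (F l)) ` ?S \<subseteq> ?I" "(\<lambda>l. cnj_index (F l)) ` ?S \<subseteq> ?I"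
      by (fastforce simp: entry_indices_def g_index_def cnj_index_def)+
    from wick_formula[OF _ ind gaussian _ this]
    show "integrable M (\<lambda>\<omega>. \<Prod>l\<in>?S. factor_pair \<omega> (F l))"
      "expectation (\<lambda>\<omega>. \<Prod>l\<in>?S. factor_pair \<omega> (F l)) = of_nat (card {\<sigma>. \<sigma> permutes ?S \<and> ?match F \<sigma>})"
      unfolding fp by simp_all
  qed
  have finX: "finite ?X" by (intro finite_cartesian_product finite_PiE finite_lessThan finite_labels finite_D)
  have int: "integrable M (\<lambda>\<omega>. case x of (r, F) \<Rightarrow> ?c r F * (\<Prod>l\<in>?S. factor_pair \<omega> (F l)))" if "x \<in> ?X" for x
    using that wick(1) by (auto intro!: integrable_mult_right simp del: of_bool_eq_iff split: prod.splits)
  show ?int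
    unfolding normalized_trace_word[OF xs]
    by (intro integrable_divide Bochner_Integration.integrable_sum int)
  have "expectation (\<lambda>\<omega>. normalized_trace (word_mat N (wishart_letter d1 d2 p g \<omega>) (map (fst \<circ> snd) xs))) =
      (\<Sum>x\<in>?X. expectation (\<lambda>\<omega>. case x of (r, F) \<Rightarrow> ?c r F * (\<Prod>l\<in>?S. factor_pair \<omega> (F l)))) / ?n"
    unfolding normalized_trace_word[OF xs] integral_divide_zero
    by (subst Bochner_Integration.integral_sum) (use int in auto)
  also have "(\<Sum>x\<in>?X. expectation (\<lambda>\<omega>. case x of (r, F) \<Rightarrow> ?c r F * (\<Prod>l\<in>?S. factor_pair \<omega> (F l)))) =
      (\<Sum>x\<in>?X. \<Sum>\<sigma> | \<sigma> permutes ?S. of_bool (word_constraint (snd x) (fst x) xs (fst x) \<and> ?match (snd x) \<sigma>))"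
  proof (rule sum.cong[OF refl])
    fix x assume x: "x \<in> ?X"
    obtain r F where rF: "x = (r, F)" by (cases x)
    then have F: "F \<in> PiE ?S (\<lambda>_. D)" using x by simp
    have "of_nat (card {\<sigma>. \<sigma> permutes ?S \<and> ?match F \<sigma>}) = (\<Sum>\<sigma> | \<sigma> permutes ?S. of_bool (?match F \<sigma>) :: complex)"
      using finite_permutations[of ?S] by (simp add: sum_of_bool_eq Int_def conj_commute)
    then show "expectation (\<lambda>\<omega>. case x of (r, F) \<Rightarrow> ?c r F * (\<Prod>l\<in>?S. factor_pair \<omega> (F l))) =
        (\<Sum>\<sigma> | \<sigma> permutes ?S. of_bool (word_constraint (snd x) (fst x) xs (fst x) \<and> ?match (snd x) \<sigma>))"
      using wick(2)[OF F] by (simp add: rF sum_distrib_left of_bool_conj)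
  qed
  also have "\<dots> = (\<Sum>\<sigma> | \<sigma> permutes ?S. \<Sum>x\<in>?X.
      of_bool (word_constraint (snd x) (fst x) xs (fst x) \<and> ?match (snd x) \<sigma>))"
    by (rule sum.swap)
  also have "\<dots> = (\<Sum>\<sigma> | \<sigma> permutes ?S. of_nat (cycle_count p ?S \<sigma> *
      closed_count d2 (map large_dir xs) \<sigma> * closed_count d1 (map small_dir xs) \<sigma>))"
  proof (rule sum.cong[OF refl])
    fix \<sigma> assume "\<sigma> \<in> {\<sigma>. \<sigma> permutes ?S}"
    then have \<sigma>: "\<sigma> permutes ?S" by simp
    let ?T = "{(r, F). r < N \<and> F \<in> PiE ?S (\<lambda>_. D) \<and> word_constraint F r xs r \<and> ?match F \<sigma>}"
    have "(\<Sum>x\<in>?X. of_bool (word_constraint (snd x) (fst x) xs (fst x) \<and> ?match (snd x) \<sigma>)) =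
        (of_nat (card (?X \<inter> {x. word_constraint (snd x) (fst x) xs (fst x) \<and> ?match (snd x) \<sigma>})) :: complex)"
      by (rule sum_of_bool_eq[OF finX finX])
    also have "?X \<inter> {x. word_constraint (snd x) (fst x) xs (fst x) \<and> ?match (snd x) \<sigma>} = ?T"
      by (auto simp: mem_Times_iff)
    finally show "(\<Sum>x\<in>?X. of_bool (word_constraint (snd x) (fst x) xs (fst x) \<and> ?match (snd x) \<sigma>)) =
        (of_nat (cycle_count p ?S \<sigma> * closed_count d2 (map large_dir xs) \<sigma> *
          closed_count d1 (map small_dir xs) \<sigma>) :: complex)"
      unfolding card_index_matchings[OF xs(1) \<sigma>] .
  qed
  finally show ?eq
    by (simp add: stack_sum_def block_weight_def sum_divide_distrib comp_def)
qed

end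

text \<open>Labels start at 1, because 0 denotes the cut index.\<close>

definition initial_blocks :: "bool list \<Rightarrow> block list" where
  "initial_blocks w = map (\<lambda>(l, b). (l, b, 1)) (zip [1..<Suc (length w)] w)"

lemma initial_blocks:
  "labelled (initial_blocks w)" "\<forall>b\<in>set (initial_blocks w). snd (snd b) = 1"
  "map (fst \<circ> snd) (initial_blocks w) = w"
proof -
  have "map fst (initial_blocks w) = map fst (zip [1..<Suc (length w)] w)"
    by (simp add: initial_blocks_def case_prod_beta comp_def del: upt_Suc)
  also have "\<dots> = [1..<Suc (length w)]" by (rule map_fst_zip) (simp del: upt_Suc)
  finally have fst: "map fst (initial_blocks w) = [1..<Suc (length w)]" .
  have "labels (initial_blocks w) = set [1..<Suc (length w)]"
    unfolding labels_def fst[symmetric] by simp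
  then show "labelled (initial_blocks w)" by (simp add: labelled_def fst del: upt_Suc)
  show "\<forall>b\<in>set (initial_blocks w). snd (snd b) = 1" by (auto simp: initial_blocks_def)
  have "map (fst \<circ> snd) (initial_blocks w) = map snd (zip [1..<Suc (length w)] w)"
    by (simp add: initial_blocks_def case_prod_beta comp_def del: upt_Suc)
  also have "\<dots> = w" by (rule map_snd_zip) (simp del: upt_Suc)
  finally show "map (fst \<circ> snd) (initial_blocks w) = w" .
qed

lemma normalized_trace_word_0:
  "normalized_trace (word_mat 0 (wishart_letter d1 0 p g \<omega>) w) = 0"
  by (cases w) (simp_all add: normalized_trace_def word_mat_def wishart_letter_def wishart_def
      wishart_right_transpose_def block_matrix_def)

theorem theorem2:
  fixes d1 :: nat
    and c :: real
    and p :: "nat \<Rightarrow> nat"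
    and M :: "nat \<Rightarrow> 'w measure"
    and g :: "nat \<Rightarrow> nat \<Rightarrow> nat \<Rightarrow> nat \<Rightarrow> 'w \<Rightarrow> complex"
  assumes "d1 \<ge> 1"
    and "0 < c"
    and "(\<lambda>d2. real (p d2) / (real d1 * real d2)) \<longlonglongrightarrow> c"
    and "\<And>d2. gaussian_entries (M d2) d1 d2 (p d2) (g d2)"
  shows "asymptotically_free M (\<lambda>d2. d1 * d2)
           (\<lambda>d2 (b::bool). if b then wishart d1 d2 (p d2) (g d2)
                           else wishart_right_transpose d1 d2 (p d2) (g d2))"
proof -
  interpret stack_machine "close_weight d1 (of_real c)" "merge_weight d1" .
  let ?X = "\<lambda>d2 (b::bool). if b then wishart d1 d2 (p d2) (g d2)
      else wishart_right_transpose d1 d2 (p d2) (g d2)"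
  have d1: "d1 > 0" using assms(1) by simp
  have letter: "(\<lambda>i. ?X d2 i \<omega>) = wishart_letter d1 d2 (p d2) (g d2) \<omega>" for d2 \<omega>
    by (auto simp: wishart_letter_def)
  have "joint_moments_converge M (\<lambda>d2. d1 * d2) ?X state nc_var"
    unfolding joint_moments_converge_def letter
  proof (intro allI conjI)
    fix w :: "bool list" and d2
    show "integrable (M d2) (\<lambda>\<omega>. normalized_trace
        (word_mat (d1 * d2) (wishart_letter d1 d2 (p d2) (g d2) \<omega>) w))"
    \<comment> \<open>Integrability is demanded for every \<open>d2\<close>. For empty matrices the
      normalised trace is 0 by the convention for division by 0.\<close>
    proof (cases "d2 = 0")
      case True
      then show ?thesis by (simp add: normalized_trace_word_0)
    next
      case False
      then show ?thesis
        using integrable_normalized_trace_word[OF d1 _ assms(4) initial_blocks(1,2), of d2 w]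
        unfolding initial_blocks(3) by simp
    qed
  next
    fix w :: "bool list"
    have "(\<lambda>d2. stack_sum d1 d2 (p d2) [] (initial_blocks w)) \<longlonglongrightarrow> state (prod_list (map nc_var w))"
      using stack_sum_tendsto[OF d1 assms(2,3), of "[]" "initial_blocks w"] initial_blocks[of w]
      by (simp add: state_word)
    then show "(\<lambda>d2. integral\<^sup>L (M d2) (\<lambda>\<omega>. normalized_trace
        (word_mat (d1 * d2) (wishart_letter d1 d2 (p d2) (g d2) \<omega>) w))) \<longlonglongrightarrow> state (prod_list (map nc_var w))"
    proof (rule Lim_transform_eventually)
      show "\<forall>\<^sub>F d2 in sequentially. stack_sum d1 d2 (p d2) [] (initial_blocks w) =
          integral\<^sup>L (M d2) (\<lambda>\<omega>. normalized_trace
            (word_mat (d1 * d2) (wishart_letter d1 d2 (p d2) (g d2) \<omega>) w))"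
        using eventually_gt_at_top[of 0]
      proof eventually_elim
        case (elim d2)
        show ?case
          using integral_normalized_trace_word[OF d1 elim assms(4) initial_blocks(1,2), of w]
          unfolding initial_blocks(3) by (rule sym)
      qed
    qed
  qed
  then show ?thesis
    unfolding asymptotically_free_def using state_nc_prob_space state_free by blast
qed

end
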